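(* Let $C_{\phi,w}$ be densely defined in $L^2(\mu)$, and suppose that $E_{\phi,w}(h_{\phi,w})=h_{\phi,w}$ a.e. $[\mu_w]$ and $h_{\phi,w}\circ\phi\leq h_{\phi,w}$ a.e. $[\mu_w]$. Then there is a nontrivial invariant subspace $\mathcal M$ for $C_{\phi,w}$. If the kernels of $C_{\phi,w}$ and $C_{\phi,w}^*$ are trivial, and $C_{\phi,w}$ is not a scalar multiple of an isometry, then the subspace $\mathcal M$ is of the form $\chi_{\{h_{\phi,w}>t_0\}}L^2(\mu)$ for some $t_0\in\mathbb R$.
   Context: $(X,\mathscr A,\mu)$ is a $\sigma$-finite measure space, $\phi\colon X\to X$ and $w\colon X\to\mathbb C$ are $\mathscr A$-measurable, $\mu_w(\sigma)=\int_\sigma|w|^2\,d\mu$ for $\sigma\in\mathscr A$, and the measure $\mu_w\circ\phi^{-1}$, $\sigma\mapsto\mu_w(\phi^{-1}(\sigma))$, is assumed absolutely continuous with respect to $\mu$. The (possibly unbounded) weighted composition operator $C_{\phi,w}$ in the complex Hilbert space $L^2(\mu)$ has domain $\{f\in L^2(\mu): w\cdot(f\circ\phi)\in L^2(\mu)\}$ and acts by $C_{\phi,w}f=w\cdot(f\circ\phi)$; $C_{\phi,w}^*$ denotes its adjoint. The function $h_{\phi,w}\colon X\to[0,\infty]$ is the Radon-Nikodym derivative, i.e. the (up to $\mu$-null sets) unique $\mathscr A$-measurable function with $\mu_w(\phi^{-1}(\Delta))=\int_\Delta h_{\phi,w}\,d\mu$ for all $\Delta\in\mathscr A$. $E_{\phi,w}(f)$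 denotes the conditional expectation of an $\mathscr A$-measurable $f\colon X\to[0,\infty]$ with respect to the $\sigma$-algebra $\phi^{-1}(\mathscr A)$ and the measure $\mu_w$: the (up to $\mu_w$-null sets) unique $\phi^{-1}(\mathscr A)$-measurable function with $\int_\Delta f\,d\mu_w=\int_\Delta E_{\phi,w}(f)\,d\mu_w$ for all $\Delta\in\phi^{-1}(\mathscr A)$ (it exists whenever $C_{\phi,w}$ is densely defined). If $T$ is an operator in a Hilbert space $\mathcal H$ with domain $\mathcal D(T)$, a closed subspace $\mathcal M\subseteq\mathcal H$ is invariant for $T$ if $T(\mathcal M\cap\mathcal D(T))\subseteq\mathcal M$; it is nontrivial if $\mathcal M\neq\{0\}$ and $\mathcal M\neq\mathcal H$. A kernel is trivial if it equals $\{0\}$. $\chi_S L^2(\mu)=\{\chi_S f: f\in L^2(\mu)\}$, where $\chi_S$ is the indicator function of $S$.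
   Formalization: It is additionally assumed that L²(μ) has dimension at least 2; without this no nontrivial subspace exists (e.g. X a single atom, φ = id, w = 1). *)

theory Defs
  imports "HOL-Probability.Conditional_Expectation"
begin

text \<open>
  Elements of the complex Hilbert space \<open>L\<^sup>2(M)\<close> are represented by square-integrable functions.
  Functions equal almost everywhere stand for the same element, so equality in
  \<open>L\<^sup>2(M)\<close> is written out as equality almost everywhere, a subset of \<open>L\<^sup>2(M)\<close> is a set of functions
  containing with a function all square-integrable functions almost everywhere equal to it, and
  the zero subspace is \<open>l2_zero\<close>.
\<close>

definition l2_space :: "'a measure \<Rightarrow> ('a \<Rightarrow> complex) set" where
  "l2_space M = {f \<in> borel_measurable M. integrable M (\<lambda>x. (cmod (f x))\<^sup>2)}"

definition l2_inner :: "'a measure \<Rightarrow> ('a \<Rightarrow> complex) \<Rightarrow> ('a \<Rightarrow> complex) \<Rightarrow> complex" where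
  "l2_inner M f g = (\<integral>x. f x * cnj (g x) \<partial>M)"

definition l2_norm :: "'a measure \<Rightarrow> ('a \<Rightarrow> complex) \<Rightarrow> real" where
  "l2_norm M f = sqrt (\<integral>x. (cmod (f x))\<^sup>2 \<partial>M)"

definition l2_zero :: "'a measure \<Rightarrow> ('a \<Rightarrow> complex) set" where
  "l2_zero M = {f \<in> l2_space M. AE x in M. f x = 0}"

text \<open>Sequential closedness makes \<open>S\<close> stable under almost everywhere equality (use a constant
  sequence).\<close>

definition l2_closed_subspace :: "'a measure \<Rightarrow> ('a \<Rightarrow> complex) set \<Rightarrow> bool" where
  "l2_closed_subspace M S \<longleftrightarrow>
     S \<subseteq> l2_space M \<and> (\<lambda>x. 0) \<in> S \<and>
     (\<forall>f\<in>S. \<forall>g\<in>S. \<forall>a b. (\<lambda>x. a * f x + b * g x) \<in> S) \<and>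
     (\<forall>F f. (\<forall>n. F n \<in> S) \<and> f \<in> l2_space M \<and> (\<lambda>n. l2_norm M (\<lambda>x. F n x - f x)) \<longlonglongrightarrow> 0
        \<longrightarrow> f \<in> S)"

text \<open>A possibly unbounded operator in \<open>L\<^sup>2(M)\<close> is represented by its graph; its domain is the
  \<open>Domain\<close> of the graph.\<close>

type_synonym 'a l2_op = "(('a \<Rightarrow> complex) \<times> ('a \<Rightarrow> complex)) set"

definition l2_densely_defined :: "'a measure \<Rightarrow> 'a l2_op \<Rightarrow> bool" where
  "l2_densely_defined M T \<longleftrightarrow>
     (\<forall>f\<in>l2_space M. \<forall>e>0. \<exists>g\<in>Domain T. l2_norm M (\<lambda>x. f x - g x) < e)"

text \<open>The graph of an operator when \<open>T\<close> is densely defined.\<close>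

definition l2_adjoint :: "'a measure \<Rightarrow> 'a l2_op \<Rightarrow> 'a l2_op" where
  "l2_adjoint M T = {(g, k). g \<in> l2_space M \<and> k \<in> l2_space M \<and>
     (\<forall>(f, u)\<in>T. l2_inner M u g = l2_inner M f k)}"

definition l2_kernel :: "'a measure \<Rightarrow> 'a l2_op \<Rightarrow> ('a \<Rightarrow> complex) set" where
  "l2_kernel M T = {f. \<exists>u. (f, u) \<in> T \<and> (AE x in M. u x = 0)}"

text \<open>Linearity and preservation of the norm make the graph single-valued up to almost everywhere
  equality, and the domain is the whole space.\<close>

definition l2_isometry :: "'a measure \<Rightarrow> 'a l2_op \<Rightarrow> bool" where
  "l2_isometry M V \<longleftrightarrow>
     V \<subseteq> l2_space M \<times> l2_space M \<and> Domain V = l2_space M \<and>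
     (\<forall>(f, u)\<in>V. \<forall>(g, v)\<in>V. \<forall>a b. (\<lambda>x. a * f x + b * g x, \<lambda>x. a * u x + b * v x) \<in> V) \<and>
     (\<forall>(f, u)\<in>V. l2_norm M u = l2_norm M f)"

definition l2_scale :: "'a measure \<Rightarrow> complex \<Rightarrow> 'a l2_op \<Rightarrow> 'a l2_op" where
  "l2_scale M c T = {(f, u). u \<in> l2_space M \<and> (\<exists>v. (f, v) \<in> T \<and> (AE x in M. u x = c * v x))}"

definition l2_invariant :: "'a l2_op \<Rightarrow> ('a \<Rightarrow> complex) set \<Rightarrow> bool" where
  "l2_invariant T S \<longleftrightarrow> (\<forall>(f, u)\<in>T. f \<in> S \<longrightarrow> u \<in> S)"

definition l2_restrict :: "'a measure \<Rightarrow> 'a set \<Rightarrow> ('a \<Rightarrow> complex) set" where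
  "l2_restrict M A =
     {g \<in> l2_space M. \<exists>f\<in>l2_space M. AE x in M. g x = indicator A x * f x}"

definition weighted_measure :: "'a measure \<Rightarrow> ('a \<Rightarrow> complex) \<Rightarrow> 'a measure" where
  "weighted_measure M w = density M (\<lambda>x. ennreal ((cmod (w x))\<^sup>2))"

definition wco :: "'a measure \<Rightarrow> ('a \<Rightarrow> 'a) \<Rightarrow> ('a \<Rightarrow> complex) \<Rightarrow> 'a l2_op" where
  "wco M \<phi> w = {(f, u). f \<in> l2_space M \<and> u \<in> l2_space M \<and> (AE x in M. u x = w x * f (\<phi> x))}"

definition wco_h :: "'a measure \<Rightarrow> ('a \<Rightarrow> 'a) \<Rightarrow> ('a \<Rightarrow> complex) \<Rightarrow> 'a \<Rightarrow> ennreal" where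
  "wco_h M \<phi> w = RN_deriv M (distr (weighted_measure M w) M \<phi>)"

definition wco_E :: "'a measure \<Rightarrow> ('a \<Rightarrow> 'a) \<Rightarrow> ('a \<Rightarrow> complex) \<Rightarrow> ('a \<Rightarrow> ennreal) \<Rightarrow> 'a \<Rightarrow> ennreal" where
  "wco_E M \<phi> w = nn_cond_exp (weighted_measure M w) (vimage_algebra (space M) \<phi> M)"

lemma Domain_wco:
  assumes "\<phi> \<in> measurable M M" "w \<in> borel_measurable M"
  shows "Domain (wco M \<phi> w) = {f \<in> l2_space M. (\<lambda>x. w x * f (\<phi> x)) \<in> l2_space M}"
proof (intro equalityI subsetI)
  fix f assume "f \<in> Domain (wco M \<phi> w)"
  then obtain u where f: "f \<in> l2_space M" and u: "u \<in> l2_space M"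
    and eq: "AE x in M. u x = w x * f (\<phi> x)"
    by (auto simp: wco_def)
  have [measurable]: "f \<in> borel_measurable M" "u \<in> borel_measurable M"
    "\<phi> \<in> measurable M M" "w \<in> borel_measurable M"
    using f u assms by (auto simp: l2_space_def)
  have "integrable M (\<lambda>x. (cmod (u x))\<^sup>2)"
    using u by (simp add: l2_space_def)
  then have "integrable M (\<lambda>x. (cmod (w x * f (\<phi> x)))\<^sup>2)"
  proof (subst integrable_cong_AE[of _ M "\<lambda>x. (cmod (u x))\<^sup>2"])
    show "AE x in M. (cmod (w x * f (\<phi> x)))\<^sup>2 = (cmod (u x))\<^sup>2"
      using eq by eventually_elim simp
  qed measurable
  with f show "f \<in> {f \<in> l2_space M. (\<lambda>x. w x * f (\<phi> x)) \<in> l2_space M}"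
    by (simp add: l2_space_def)
qed (auto simp: wco_def)

end

theory Submission
  imports Defs "HOL-Library.Function_Algebras" "HOL-Probability.Essential_Supremum"
begin

text \<open>
  Write \<open>h\<close> for the Radon-Nikodym derivative and \<open>C\<close> for the weighted composition operator. Changing
  variables gives \<open>\<integral>\<bar>C f\<bar>\<^sup>2 = \<integral>h \<bar>f\<bar>\<^sup>2\<close> (\<open>nn_integral_wco\<close>), and everything depends on whether \<open>h\<close> is
  essentially constant.

  Suppose that it is not. Then some level \<open>t \<ge> 0\<close> splits \<open>h\<close> nontrivially, so that the functions living
  on \<open>{h > t}\<close> form a nontrivial closed subspace. If \<open>f\<close> vanishes off \<open>{h > t}\<close>, then at almost every point
  with \<open>w \<noteq> 0\<close> and \<open>h \<le> t\<close> also \<open>h \<circ> \<phi> \<le> h \<le> t\<close>, so \<open>f \<circ> \<phi>\<close> vanishes there; hence the subspace is invariant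
  (\<open>level_set_invariant\<close>). It has the form demanded in the second half of the theorem.

  Suppose that \<open>h\<close> is essentially a constant \<open>c\<close>. Dense definedness excludes \<open>c = \<infinity>\<close>, and then
  \<open>\<parallel>C f\<parallel>\<^sup>2 = c \<parallel>f\<parallel>\<^sup>2\<close> makes \<open>C\<close> a scalar multiple of an isometry \<open>U\<close>, so only some invariant subspace of
  \<open>U\<close> is wanted. If \<open>U\<close> acts as a scalar, the orthogonal complement of a vector will do, and if
  \<open>U\<close> is not onto, its range will do. The remaining case is a nonscalar unitary \<open>U\<close>, for which the
  following argument stands in for the spectral theorem.

  One of the symmetric operators \<open>U + U\<^sup>-\<^sup>1\<close> and \<open>\<i> (U - U\<^sup>-\<^sup>1)\<close> is not a scalar. Shifting and scaling it
  gives a symmetric contraction \<open>T\<close> that commutes with \<open>U\<close> and whose quadratic form takes both signs.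
  Let \<open>\<bar>T\<bar>\<close> be the positive square root of \<open>T\<^sup>2\<close>. Then \<open>(\<bar>T\<bar> - T) (\<bar>T\<bar> + T) = 0\<close>, so the kernel of
  \<open>\<bar>T\<bar> - T\<close>, where the negative part of \<open>T\<close> vanishes, is invariant under all that commutes with \<open>T\<close>; it is
  not everything because the form of \<open>T\<close> is negative somewhere, and not zero because the form is positive
  somewhere (\<open>symmetric_contraction_invariant_subspace\<close>). The square root is the limit of a quadratic
  iteration, and the kernel can be described through the iterates without ever forming the limit operator; here
  completeness of \<open>L\<^sup>2\<close> (\<open>l2_complete\<close>) serves only to exhibit one nonzero vector in it.
\<close>


section \<open>Complete spaces with a semi-inner product\<close>

text \<open>
  Vectors are kept as representatives, so the form may be degenerate: two vectors with
  \<open>nrm (x - y) = 0\<close> stand for the same element. The carrier \<open>H\<close> is a subspace of an ambient space because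
  the square-integrable functions depend on a measure and do not form a type. Only the real part of the
  complex inner product enters: complex linearity of a subspace is invariance under multiplication by
  \<open>\<i>\<close>, which is carried along below as one more operator \<open>J\<close>.
\<close>

locale semi_hilbert =
  fixes H :: "'v::real_vector set" and B :: "'v \<Rightarrow> 'v \<Rightarrow> real"
  assumes subspace_H: "subspace H"
    and B_commute: "x \<in> H \<Longrightarrow> y \<in> H \<Longrightarrow> B x y = B y x"
    and B_add: "x \<in> H \<Longrightarrow> y \<in> H \<Longrightarrow> z \<in> H \<Longrightarrow> B (x + y) z = B x z + B y z"
    and B_scaleR: "x \<in> H \<Longrightarrow> y \<in> H \<Longrightarrow> B (r *\<^sub>R x) y = r * B x y"
    and B_nonneg: "x \<in> H \<Longrightarrow> 0 \<le> B x x"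
    and complete: "(\<And>n. F n \<in> H) \<Longrightarrow>
      (\<And>e. 0 < e \<Longrightarrow> \<exists>N. \<forall>m\<ge>N. \<forall>n\<ge>N. sqrt (B (F m - F n) (F m - F n)) < e) \<Longrightarrow>
      \<exists>x\<in>H. (\<lambda>n. sqrt (B (F n - x) (F n - x))) \<longlonglongrightarrow> 0"
begin

definition nrm :: "'v \<Rightarrow> real" where
  "nrm x = sqrt (B x x)"

definition closed_subspace :: "'v set \<Rightarrow> bool" where
  "closed_subspace S \<longleftrightarrow> S \<subseteq> H \<and> subspace S \<and>
     (\<forall>F x. (\<forall>n. F n \<in> S) \<and> x \<in> H \<and> (\<lambda>n. nrm (F n - x)) \<longlonglongrightarrow> 0 \<longrightarrow> x \<in> S)"

text \<open>
  Linearity on the whole ambient space lets algebraic identities between operators hold as equations of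
  vectors rather than up to null vectors.
\<close>

definition bounded_operator :: "real \<Rightarrow> ('v \<Rightarrow> 'v) \<Rightarrow> bool" where
  "bounded_operator c T \<longleftrightarrow> linear T \<and> (\<forall>x\<in>H. T x \<in> H \<and> nrm (T x) \<le> c * nrm x)"

lemma H_closed [simp]:
  "0 \<in> H" "x \<in> H \<Longrightarrow> y \<in> H \<Longrightarrow> x + y \<in> H" "x \<in> H \<Longrightarrow> y \<in> H \<Longrightarrow> x - y \<in> H"
  "x \<in> H \<Longrightarrow> - x \<in> H" "x \<in> H \<Longrightarrow> r *\<^sub>R x \<in> H"
  using subspace_H by (auto simp: subspace_0 subspace_add subspace_diff subspace_scale subspace_neg)

lemma bounded_operatorD:
  assumes "bounded_operator c T"
  shows "linear T" "x \<in> H \<Longrightarrow> T x \<in> H" "x \<in> H \<Longrightarrow> nrm (T x) \<le> c * nrm x"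
    "T (x + y) = T x + T y" "T (x - y) = T x - T y" "T (r *\<^sub>R x) = r *\<^sub>R T x" "T 0 = 0"
  using assms by (auto simp: bounded_operator_def linear_add linear_diff linear_scale linear_0)

lemma B_add_right: "x \<in> H \<Longrightarrow> y \<in> H \<Longrightarrow> z \<in> H \<Longrightarrow> B z (x + y) = B z x + B z y"
  by (simp add: B_commute[of z] B_add)

lemma B_scaleR_right: "x \<in> H \<Longrightarrow> y \<in> H \<Longrightarrow> B y (r *\<^sub>R x) = r * B y x"
  by (simp add: B_commute[of y] B_scaleR)

lemma B_minus: "x \<in> H \<Longrightarrow> y \<in> H \<Longrightarrow> B (- x) y = - B x y"
  using B_scaleR[of x y "-1"] by simp

lemma B_minus_right: "x \<in> H \<Longrightarrow> y \<in> H \<Longrightarrow> B x (- y) = - B x y"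
  using B_scaleR_right[of y x "-1"] by simp

lemma B_diff: "x \<in> H \<Longrightarrow> y \<in> H \<Longrightarrow> z \<in> H \<Longrightarrow> B (x - y) z = B x z - B y z"
  using B_add[of x "- y" z] by (simp add: B_minus)

lemma B_diff_right: "x \<in> H \<Longrightarrow> y \<in> H \<Longrightarrow> z \<in> H \<Longrightarrow> B z (x - y) = B z x - B z y"
  by (simp add: B_commute[of z] B_diff)

lemmas B_simps = B_add B_add_right B_scaleR B_scaleR_right B_minus B_minus_right B_diff B_diff_right

lemma nrm_square: "x \<in> H \<Longrightarrow> (nrm x)\<^sup>2 = B x x"
  by (simp add: nrm_def B_nonneg)

lemma nrm_nonneg [simp]: "x \<in> H \<Longrightarrow> 0 \<le> nrm x"
  by (simp add: nrm_def B_nonneg)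

lemma nrm_scaleR: "x \<in> H \<Longrightarrow> nrm (r *\<^sub>R x) = \<bar>r\<bar> * nrm x"
  by (simp add: nrm_def B_simps real_sqrt_mult flip: mult.assoc)

lemma nrm_zero [simp]: "nrm 0 = 0"
  using nrm_scaleR[of 0 0] by simp

lemma nrm_minus: "x \<in> H \<Longrightarrow> nrm (- x) = nrm x"
  using nrm_scaleR[of x "-1"] by simp

lemma nrm_minus_commute: "x \<in> H \<Longrightarrow> y \<in> H \<Longrightarrow> nrm (x - y) = nrm (y - x)"
  using nrm_minus[of "x - y"] by simp

lemma Cauchy_Schwarz:
  assumes x: "x \<in> H" and y: "y \<in> H"
  shows "\<bar>B x y\<bar> \<le> nrm x * nrm y"
proof -
  have quad: "0 \<le> B x x - 2 * r * B x y + r\<^sup>2 * B y y" for r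
  proof -
    have "0 \<le> B (x - r *\<^sub>R y) (x - r *\<^sub>R y)"
      using x y by (intro B_nonneg) simp
    also have "\<dots> = B x x - 2 * r * B x y + r\<^sup>2 * B y y"
      using x y by (simp add: B_simps B_commute[of y x] power2_eq_square algebra_simps)
    finally show ?thesis .
  qed
  have "(B x y)\<^sup>2 \<le> B x x * B y y"
  proof (cases "B y y = 0")
    case True
    have "B x y = 0"
    proof (rule ccontr)
      assume "B x y \<noteq> 0"
      with quad[of "(B x x + 1) / (2 * B x y)"] True show False
        by (simp add: field_simps)
    qed
    then show ?thesis by (simp add: True)
  next
    case False
    then have pos: "0 < B y y" using B_nonneg[OF y] by simp
    have "0 \<le> B x x - (B x y)\<^sup>2 / B y y"
      using quad[of "B x y / B y y"] pos by (simp add: field_simps power2_eq_square)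
    then show ?thesis using pos by (simp add: field_simps)
  qed
  then have "(B x y)\<^sup>2 \<le> (nrm x * nrm y)\<^sup>2"
    by (simp add: power_mult_distrib nrm_square x y)
  then show ?thesis
    using x y by (metis abs_le_square_iff abs_of_nonneg mult_nonneg_nonneg nrm_nonneg)
qed

lemma nrm_triangle:
  assumes x: "x \<in> H" and y: "y \<in> H"
  shows "nrm (x + y) \<le> nrm x + nrm y"
proof (rule power2_le_imp_le)
  have "(nrm (x + y))\<^sup>2 = B x x + 2 * B x y + B y y"
    using x y by (simp add: nrm_square B_simps B_commute[of y x])
  also have "\<dots> \<le> (nrm x + nrm y)\<^sup>2"
    using Cauchy_Schwarz[OF x y] x y by (simp add: power2_sum nrm_square)
  finally show "(nrm (x + y))\<^sup>2 \<le> (nrm x + nrm y)\<^sup>2" .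
qed (use x y in auto)

lemma nrm_triangle_diff: "x \<in> H \<Longrightarrow> y \<in> H \<Longrightarrow> nrm (x - y) \<le> nrm x + nrm y"
  using nrm_triangle[of x "- y"] by (simp add: nrm_minus)

lemma B_eq_0_right: "x \<in> H \<Longrightarrow> y \<in> H \<Longrightarrow> nrm y = 0 \<Longrightarrow> B x y = 0"
  using Cauchy_Schwarz[of x y] by simp

lemma B_cong_right:
  assumes "x \<in> H" "y \<in> H" "z \<in> H" "nrm (y - z) = 0"
  shows "B x y = B x z"
  using B_eq_0_right[of x "y - z"] assms by (simp add: B_simps)

lemma nrm_cong:
  assumes "y \<in> H" "z \<in> H" "nrm (y - z) = 0"
  shows "nrm y = nrm z"
  using nrm_triangle[of "y - z" z] nrm_triangle[of "z - y" y] nrm_minus_commute[of y z] assms by simp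

lemma nrm_le_0_iff: "x \<in> H \<Longrightarrow> nrm x \<le> 0 \<longleftrightarrow> nrm x = 0"
  using nrm_nonneg[of x] by linarith

lemma nrm_eq_0_trans:
  assumes "x \<in> H" "y \<in> H" "z \<in> H" "nrm (x - y) = 0" "nrm (y - z) = 0"
  shows "nrm (x - z) = 0"
  using nrm_triangle[of "x - y" "y - z"] assms by (simp add: nrm_le_0_iff)

lemma bounded_operator_null:
  assumes "bounded_operator c T" "x \<in> H" "nrm x = 0"
  shows "nrm (T x) = 0"
  using bounded_operatorD(3)[OF assms(1,2)] bounded_operatorD(2)[OF assms(1,2)] assms by (simp add: nrm_le_0_iff)

lemma tendsto_nrm_0I:
  assumes "\<And>n. F n \<in> H" "\<And>n. nrm (F n) \<le> g n" "g \<longlonglongrightarrow> 0"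
  shows "(\<lambda>n. nrm (F n)) \<longlonglongrightarrow> 0"
  by (rule tendsto_sandwich[of "\<lambda>_. 0" _ _ g]) (use assms in auto)

lemma tendsto_nrm_0D:
  assumes "(\<lambda>n. nrm (F n)) \<longlonglongrightarrow> 0" "0 < e"
  shows "\<exists>N. \<forall>n\<ge>N. nrm (F n) < e"
  using LIMSEQ_D[OF assms] by (metis abs_less_iff diff_zero real_norm_def)

lemma completeD:
  assumes "\<And>n. F n \<in> H"
    and "\<And>e. 0 < e \<Longrightarrow> \<exists>N. \<forall>m\<ge>N. \<forall>n\<ge>N. nrm (F m - F n) < e"
  obtains x where "x \<in> H" "(\<lambda>n. nrm (F n - x)) \<longlonglongrightarrow> 0"
  using complete[of F] assms unfolding nrm_def by blast

end

section \<open>Approximating a square root\<close>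

text \<open>
  The scalar case of the iteration \<open>Y \<mapsto> (K + Y\<^sup>2) / 2\<close>, at \<open>K = 1\<close>. Its increments majorise those of the operator
  iteration, so its convergence is all that the operator iteration needs.
\<close>

primrec root_bound :: "nat \<Rightarrow> real" where
  "root_bound 0 = 0"
| "root_bound (Suc n) = (1 + (root_bound n)\<^sup>2) / 2"

lemma root_bound_range: "0 \<le> root_bound n \<and> root_bound n \<le> 1"
  by (induction n) (auto simp: power_le_one)

lemma root_bound_mono: "mono root_bound"
proof (rule incseq_SucI)
  fix n
  have "0 \<le> (1 - root_bound n)\<^sup>2" by simp
  then show "root_bound n \<le> root_bound (Suc n)"
    by (simp add: power2_eq_square algebra_simps)
qed

lemma root_bound_convergent: "convergent root_bound"
  using root_bound_mono root_bound_range
  by (intro Bseq_monoseq_convergent incseq_imp_monoseq BseqI'[of _ 1]) auto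

context semi_hilbert
begin

text \<open>
  For a contraction \<open>K\<close> the iterates \<open>Y\<close> of \<open>Y \<mapsto> (K + Y\<^sup>2) / 2\<close> tend to a fixed point, and
  \<open>Y = (K + Y\<^sup>2) / 2\<close> says \<open>(1 - Y)\<^sup>2 = 1 - K\<close>. So \<open>1 - Y\<close> approaches the positive square root of \<open>1 - K\<close>,
  and \<open>Y\<close> measures its distance from the identity.
\<close>

primrec root_defect :: "('v \<Rightarrow> 'v) \<Rightarrow> nat \<Rightarrow> 'v \<Rightarrow> 'v" where
  "root_defect K 0 x = 0"
| "root_defect K (Suc n) x = (1/2) *\<^sub>R (K x + root_defect K n (root_defect K n x))"

lemma bounded_operator_root_defect:
  assumes K: "bounded_operator 1 K"
  shows "bounded_operator (root_bound n) (root_defect K n)"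
proof (induction n)
  case 0
  have "root_defect K 0 = (\<lambda>x. 0)" by (rule ext) simp
  then show ?case by (simp add: bounded_operator_def module_hom_zero)
next
  case (Suc n)
  note D = bounded_operatorD[OF Suc] bounded_operatorD[OF K]
  show ?case
    unfolding bounded_operator_def
  proof (intro conjI ballI)
    show "linear (root_defect K (Suc n))"
      by (rule linearI) (simp_all add: D algebra_simps)
    fix x assume x: "x \<in> H"
    then show "root_defect K (Suc n) x \<in> H" by (simp add: D)
    have "nrm (root_defect K (Suc n) x) \<le> (nrm (K x) + nrm (root_defect K n (root_defect K n x))) / 2"
      using nrm_triangle[of "K x" "root_defect K n (root_defect K n x)"] x
      by (simp add: nrm_scaleR D)
    also have "\<dots> \<le> (nrm x + root_bound n * (root_bound n * nrm x)) / 2"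
    proof -
      have "nrm (root_defect K n (root_defect K n x)) \<le> root_bound n * nrm (root_defect K n x)"
        by (rule D(3)[OF D(2)[OF x]])
      also have "\<dots> \<le> root_bound n * (root_bound n * nrm x)"
        using D(3)[OF x] root_bound_range[of n] by (intro mult_left_mono) auto
      finally show ?thesis using D(10)[OF x] by simp
    qed
    also have "\<dots> = root_bound (Suc n) * nrm x"
      by (simp add: power2_eq_square algebra_simps)
    finally show "nrm (root_defect K (Suc n) x) \<le> root_bound (Suc n) * nrm x" .
  qed
qed

lemma root_defect_commute:
  assumes "linear W" "linear K" "\<And>x. W (K x) = K (W x)"
  shows "W (root_defect K n x) = root_defect K n (W x)"
proof (induction n arbitrary: x)
  case 0
  then show ?case by (simp add: linear_0 assms)
next
  case (Suc n)
  then show ?case using assms by (simp add: linear_scale linear_add)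
qed

text \<open>
  The inverse of a surjective isometry is an inverse up to null vectors only, so commutation is needed
  in this weaker form too.
\<close>

lemma root_defect_commute_null:
  assumes K: "bounded_operator 1 K" and W: "bounded_operator c W"
    and comm: "\<And>x. x \<in> H \<Longrightarrow> nrm (W (K x) - K (W x)) = 0" and x: "x \<in> H"
  shows "nrm (W (root_defect K n x) - root_defect K n (W x)) = 0"
  using x
proof (induction n arbitrary: x)
  case 0
  then show ?case by (simp add: bounded_operatorD[OF W])
next
  case (Suc n)
  let ?Y = "root_defect K n"
  note Y = bounded_operator_root_defect[OF K, of n]
  note D = bounded_operatorD[OF W] bounded_operatorD[OF Y] bounded_operatorD[OF K]
  have 1: "nrm (W (?Y (?Y x)) - ?Y (W (?Y x))) = 0"
    using Suc by (simp add: D)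
  have "nrm (?Y (W (?Y x) - ?Y (W x))) = 0"
    by (rule bounded_operator_null[OF Y]) (use Suc in \<open>auto simp: D\<close>)
  then have 2: "nrm (?Y (W (?Y x)) - ?Y (?Y (W x))) = 0" by (simp add: D)
  have 3: "nrm (W (?Y (?Y x)) - ?Y (?Y (W x))) = 0"
    by (rule nrm_eq_0_trans[OF _ _ _ 1 2]) (use Suc in \<open>auto simp: D\<close>)
  have "W (root_defect K (Suc n) x) - root_defect K (Suc n) (W x) =
      (1/2) *\<^sub>R ((W (K x) - K (W x)) + (W (?Y (?Y x)) - ?Y (?Y (W x))))"
    by (simp add: D algebra_simps)
  moreover have "nrm ((W (K x) - K (W x)) + (W (?Y (?Y x)) - ?Y (?Y (W x)))) \<le> 0"
    using nrm_triangle[of "W (K x) - K (W x)" "W (?Y (?Y x)) - ?Y (?Y (W x))"] 3 comm Suc.prems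
    by (simp add: D)
  ultimately show ?case
    using Suc.prems by (simp add: nrm_scaleR nrm_le_0_iff D del: root_defect.simps)
qed

text \<open>
  All iterates commute, so with \<open>Y\<close> and \<open>Z\<close> two consecutive ones the next increment factors as
  \<open>(Y\<^sup>2 - Z\<^sup>2) / 2 = (Y + Z) (Y - Z) / 2\<close>. The same factorisation holds for the scalar iteration, which
  makes the estimate propagate.
\<close>

lemma nrm_root_defect_step:
  assumes K: "bounded_operator 1 K" and x: "x \<in> H"
  shows "nrm (root_defect K (Suc n) x - root_defect K n x) \<le> (root_bound (Suc n) - root_bound n) * nrm x"
  using x
proof (induction n arbitrary: x)
  case 0
  then show ?case using bounded_operatorD(3)[OF K, of x] by (simp add: nrm_scaleR bounded_operatorD[OF K])
next
  case (Suc n)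
  let ?Y = "root_defect K (Suc n)" and ?Z = "root_defect K n"
  let ?y = "root_bound (Suc n)" and ?z = "root_bound n"
  note Y = bounded_operator_root_defect[OF K, of "Suc n"] and Z = bounded_operator_root_defect[OF K, of n]
  note D = bounded_operatorD[OF Y] bounded_operatorD[OF Z] bounded_operatorD[OF K]
  have comm: "?Y (?Z x) = ?Z (?Y x)"
    by (intro root_defect_commute[symmetric] root_defect_commute) (auto simp: D)
  have eq: "root_defect K (Suc (Suc n)) x - ?Y x =
      (1/2) *\<^sub>R ((?Y (?Y x) + ?Z (?Y x)) - (?Y (?Z x) + ?Z (?Z x)))"
    using comm by (simp add: algebra_simps del: root_defect.simps)
       (simp add: algebra_simps)
  define v where "v = ?Y x - ?Z x"
  have v: "v \<in> H" "nrm v \<le> (?y - ?z) * nrm x"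
    using Suc unfolding v_def by (auto simp: D simp del: root_defect.simps)
  have *: "root_defect K (Suc (Suc n)) x - ?Y x = (1/2) *\<^sub>R (?Y v + ?Z v)"
    unfolding eq v_def by (simp add: D algebra_simps del: root_defect.simps)
  have "nrm (?Y v + ?Z v) \<le> (?y + ?z) * nrm v"
    using nrm_triangle[of "?Y v" "?Z v"] D(3)[of v] D(10)[of v] v D(2)[of v] D(9)[of v]
    by (simp add: algebra_simps del: root_defect.simps root_bound.simps)
  moreover have "\<dots> \<le> (?y + ?z) * ((?y - ?z) * nrm x)"
    using v root_bound_range[of n] root_bound_range[of "Suc n"]
    by (intro mult_left_mono) (auto simp del: root_bound.simps)
  moreover have "\<dots> = 2 * (root_bound (Suc (Suc n)) - ?y) * nrm x"
    by (simp only: root_bound.simps(2)[of "Suc n"]) (simp add: power2_eq_square field_simps)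
  ultimately have "nrm (?Y v + ?Z v) \<le> 2 * (root_bound (Suc (Suc n)) - ?y) * nrm x"
    by linarith
  moreover have "nrm (root_defect K (Suc (Suc n)) x - ?Y x) = nrm (?Y v + ?Z v) / 2"
    using v D(2)[of v] D(9)[of v] by (simp add: * nrm_scaleR del: root_defect.simps)
  ultimately show ?case by linarith
qed

lemma nrm_root_defect_diff:
  assumes K: "bounded_operator 1 K" and x: "x \<in> H" and mn: "m \<le> n"
  shows "nrm (root_defect K n x - root_defect K m x) \<le> (root_bound n - root_bound m) * nrm x"
  using mn
proof (induction n rule: dec_induct)
  case base
  then show ?case by simp
next
  case (step n)
  have H: "root_defect K k x \<in> H" for k
    using bounded_operatorD(2)[OF bounded_operator_root_defect[OF K]] x by blast
  show ?case
    using nrm_triangle[of "root_defect K (Suc n) x - root_defect K n x" "root_defect K n x - root_defect K m x"]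
      nrm_root_defect_step[OF K x, of n] step H
    by (simp add: algebra_simps del: root_defect.simps root_bound.simps)
qed

end

section \<open>Invariant subspaces of symmetric operators\<close>

context semi_hilbert
begin

definition symmetric :: "('v \<Rightarrow> 'v) \<Rightarrow> bool" where
  "symmetric T \<longleftrightarrow> (\<forall>x\<in>H. \<forall>y\<in>H. B (T x) y = B x (T y))"

text \<open>
  By symmetry \<open>\<parallel>x - T\<^sup>2 x\<parallel>\<^sup>2 = \<parallel>x\<parallel>\<^sup>2 - 2 \<parallel>T x\<parallel>\<^sup>2 + \<parallel>T\<^sup>2 x\<parallel>\<^sup>2\<close>, and the last term is at most
  \<open>\<parallel>T x\<parallel>\<^sup>2\<close>. The square root of \<open>1 - (1 - T\<^sup>2) = T\<^sup>2\<close> is therefore within reach of the iteration.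
\<close>

lemma nrm_square_defect_operator:
  assumes T: "bounded_operator 1 T" "symmetric T"
  shows "bounded_operator 1 (\<lambda>x. x - T (T x))"
  unfolding bounded_operator_def
proof (intro conjI ballI)
  note D = bounded_operatorD[OF T(1)]
  show "linear (\<lambda>x. x - T (T x))"
    by (rule linearI) (simp_all add: D algebra_simps)
  fix x assume x: "x \<in> H"
  then show "x - T (T x) \<in> H" by (simp add: D)
  have "(nrm (x - T (T x)))\<^sup>2 = B x x - 2 * B (T (T x)) x + B (T (T x)) (T (T x))"
    using x by (simp add: nrm_square B_simps D B_commute[of x "T (T x)"])
  also have "B (T (T x)) x = (nrm (T x))\<^sup>2"
    using T(2) x by (simp add: symmetric_def D nrm_square)
  also have "B (T (T x)) (T (T x)) \<le> (nrm (T x))\<^sup>2"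
    using D(3)[of "T x"] x by (simp add: D nrm_square[symmetric] power_mono)
  also have "B x x - 2 * (nrm (T x))\<^sup>2 + (nrm (T x))\<^sup>2 \<le> (nrm x)\<^sup>2"
    using x by (simp add: nrm_square D B_nonneg)
  finally show "nrm (x - T (T x)) \<le> 1 * nrm x"
    using power2_le_imp_le[of "nrm (x - T (T x))" "nrm x"] x by simp
qed

text \<open>
  The subspace is the kernel of \<open>\<bar>T\<bar> - T\<close>, expressed through the approximations \<open>R n\<close> of \<open>\<bar>T\<bar>\<close> as
  \<open>{x. R n x - T x \<longlonglongrightarrow> 0}\<close>. Each \<open>R n\<close> has a nonnegative form, since \<open>R n = 1 - Y n\<close> with \<open>Y n\<close> a
  contraction; hence \<open>f\<close>, where the form of \<open>T\<close> is negative, cannot belong to it. A nonzero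
  member is \<open>\<bar>T\<bar> g + T g\<close>: it is annihilated by \<open>\<bar>T\<bar> - T\<close>, and its product with \<open>g\<close> is positive.
\<close>

lemma symmetric_contraction_invariant_subspace:
  assumes T: "bounded_operator 1 T" "symmetric T"
    and f: "f \<in> H" "B (T f) f < 0" and g: "g \<in> H" "0 < B (T g) g"
  obtains S where "closed_subspace S" "\<exists>x\<in>S. nrm x \<noteq> 0" "\<exists>x\<in>H. x \<notin> S"
    "\<And>W c x. bounded_operator c W \<Longrightarrow> (\<And>x. x \<in> H \<Longrightarrow> nrm (W (T x) - T (W x)) = 0) \<Longrightarrow> x \<in> S \<Longrightarrow> W x \<in> S"
proof
  define K where "K x = x - T (T x)" for x
  have K: "bounded_operator 1 K"
    unfolding K_def by (rule nrm_square_defect_operator[OF T])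
  define Y where "Y = root_defect K"
  note oY = bounded_operator_root_defect[OF K, folded Y_def]
  note DY = bounded_operatorD[OF oY] and DT = bounded_operatorD[OF T(1)]
  have contr: "nrm (Y n x) \<le> nrm x" if "x \<in> H" for n x
    using DY(3)[OF that, of n] root_bound_range[of n] mult_right_mono[of "root_bound n" 1 "nrm x"] that
    by simp
  define R where "R n x = x - Y n x" for n x
  have oR: "bounded_operator 2 (R n)" for n
    unfolding bounded_operator_def
  proof (intro conjI ballI)
    show "linear (R n)"
      unfolding R_def by (rule linearI) (simp_all add: DY algebra_simps)
    fix x assume x: "x \<in> H"
    then show "R n x \<in> H" by (simp add: R_def DY)
    show "nrm (R n x) \<le> 2 * nrm x"
      using nrm_triangle_diff[of x "Y n x"] contr[OF x, of n] x by (simp add: R_def DY)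
  qed
  note DR = bounded_operatorD[OF oR]
  note D = DT DR DY
  \<comment> \<open>the kernel of the difference of the modulus of \<open>T\<close> and \<open>T\<close>\<close>
  define S where "S = {x\<in>H. (\<lambda>n. nrm (R n x - T x)) \<longlonglongrightarrow> 0}"
  have SH: "S \<subseteq> H" by (auto simp: S_def)
  have add: "x + y \<in> S" if x: "x \<in> S" and y: "y \<in> S" for x y
  proof -
    have H: "x \<in> H" "y \<in> H" using x y SH by auto
    have "(\<lambda>n. nrm (R n (x + y) - T (x + y))) \<longlonglongrightarrow> 0"
    proof (rule tendsto_nrm_0I)
      show "R n (x + y) - T (x + y) \<in> H" for n using H by (simp add: D)
      show "nrm (R n (x + y) - T (x + y)) \<le> nrm (R n x - T x) + nrm (R n y - T y)" for n
        using nrm_triangle[of "R n x - T x" "R n y - T y"] H by (simp add: D algebra_simps)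
      show "(\<lambda>n. nrm (R n x - T x) + nrm (R n y - T y)) \<longlonglongrightarrow> 0"
        by (rule tendsto_add_zero) (use x y in \<open>auto simp: S_def\<close>)
    qed
    then show ?thesis using H by (simp add: S_def)
  qed
  have scale: "r *\<^sub>R x \<in> S" if x: "x \<in> S" for r x
  proof -
    have H: "x \<in> H" using x SH by auto
    have "(\<lambda>n. nrm (R n (r *\<^sub>R x) - T (r *\<^sub>R x))) = (\<lambda>n. \<bar>r\<bar> * nrm (R n x - T x))"
      using H by (simp add: D nrm_scaleR flip: scaleR_diff_right)
    moreover have "\<dots> \<longlonglongrightarrow> 0"
      by (rule tendsto_mult_right_zero) (use x in \<open>auto simp: S_def\<close>)
    ultimately show ?thesis using H by (simp add: S_def)
  qed
  have zero: "0 \<in> S" by (simp add: S_def D)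
  have sub: "subspace S"
    using add scale zero by (simp add: subspace_def)
  have closed: "x \<in> S" if F: "\<And>n. F n \<in> S" and x: "x \<in> H" and lim: "(\<lambda>n. nrm (F n - x)) \<longlonglongrightarrow> 0" for F x
  proof -
    have "(\<lambda>n. nrm (R n x - T x)) \<longlonglongrightarrow> 0"
    proof (rule LIMSEQ_I)
      fix e :: real assume e: "0 < e"
      then obtain m where m: "nrm (F m - x) < e / 6"
        using tendsto_nrm_0D[OF lim, of "e / 6"] by auto
      have Fm: "F m \<in> H" and "(\<lambda>n. nrm (R n (F m) - T (F m))) \<longlonglongrightarrow> 0"
        using F[of m] by (auto simp: S_def)
      then obtain N where N: "\<And>n. n \<ge> N \<Longrightarrow> nrm (R n (F m) - T (F m)) < e / 2"
        using tendsto_nrm_0D[of "\<lambda>n. R n (F m) - T (F m)" "e / 2"] e by auto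
      have "nrm (R n x - T x) < e" if "n \<ge> N" for n
      proof -
        define v where "v = F m - x"
        have v: "v \<in> H" "nrm v < e / 6" using Fm x m by (auto simp: v_def)
        have "R n x - T x = (R n (F m) - T (F m)) - (R n v - T v)"
          by (simp add: v_def D)
        then have "nrm (R n x - T x) \<le> nrm (R n (F m) - T (F m)) + nrm (R n v - T v)"
          using nrm_triangle_diff[of "R n (F m) - T (F m)" "R n v - T v"] Fm v by (simp add: D)
        moreover have "nrm (R n v - T v) \<le> 3 * nrm v"
          using nrm_triangle_diff[OF DR(2)[OF v(1)] DT(2)[OF v(1)], of n]
            DR(3)[OF v(1), of n] DT(3)[OF v(1)] by simp
        ultimately show ?thesis using N[OF that] v by linarith
      qed
      then show "\<exists>N. \<forall>n\<ge>N. norm (nrm (R n x - T x) - 0) < e"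
        using x by (auto simp: D)
    qed
    then show ?thesis using x by (simp add: S_def)
  qed
  show "closed_subspace S"
    unfolding closed_subspace_def using SH sub closed by blast
  show "W x \<in> S" if W: "bounded_operator c W" and comm: "\<And>x. x \<in> H \<Longrightarrow> nrm (W (T x) - T (W x)) = 0"
    and x: "x \<in> S" for W c x
  proof -
    note DW = bounded_operatorD[OF W]
    have H: "x \<in> H" using x SH by auto
    have commK: "nrm (W (K y) - K (W y)) = 0" if y: "y \<in> H" for y
    proof -
      have 1: "nrm (W (T (T y)) - T (W (T y))) = 0" using comm y by (simp add: D)
      have "nrm (T (W (T y) - T (W y))) = 0"
        by (rule bounded_operator_null[OF T(1)]) (use y comm in \<open>auto simp: D DW\<close>)
      then have 2: "nrm (T (W (T y)) - T (T (W y))) = 0" by (simp add: D)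
      have "nrm (W (T (T y)) - T (T (W y))) = 0"
        by (rule nrm_eq_0_trans[OF _ _ _ 1 2]) (use y in \<open>auto simp: D DW\<close>)
      moreover have "W (K y) - K (W y) = - (W (T (T y)) - T (T (W y)))"
        by (simp add: K_def DW)
      ultimately show ?thesis using y by (simp only: nrm_minus D DW H_closed)
    qed
    have commY: "nrm (W (Y n x) - Y n (W x)) = 0" for n
      unfolding Y_def by (rule root_defect_commute_null[OF K W commK H])
    have "(\<lambda>n. nrm (R n (W x) - T (W x))) \<longlonglongrightarrow> 0"
    proof (rule tendsto_nrm_0I)
      show "R n (W x) - T (W x) \<in> H" for n using H by (simp add: D DW)
      show "nrm (R n (W x) - T (W x)) \<le> c * nrm (R n x - T x)" for n
      proof -
        have eq: "R n (W x) - T (W x) = W (R n x - T x) + ((W (Y n x) - Y n (W x)) + (W (T x) - T (W x)))"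
          by (simp add: R_def DW)
        have "nrm (W (R n x - T x) + ((W (Y n x) - Y n (W x)) + (W (T x) - T (W x))))
          \<le> nrm (W (R n x - T x)) + (nrm (W (Y n x) - Y n (W x)) + nrm (W (T x) - T (W x)))"
          using nrm_triangle[of "W (R n x - T x)" "(W (Y n x) - Y n (W x)) + (W (T x) - T (W x))"]
            nrm_triangle[of "W (Y n x) - Y n (W x)" "W (T x) - T (W x)"] H by (simp add: D DW)
        moreover have "nrm (W (R n x - T x)) \<le> c * nrm (R n x - T x)"
          by (rule DW(3)) (use H in \<open>simp add: D\<close>)
        ultimately show ?thesis
          unfolding eq using commY comm[OF H] by simp
      qed
      show "(\<lambda>n. c * nrm (R n x - T x)) \<longlonglongrightarrow> 0"
        by (rule tendsto_mult_right_zero) (use x in \<open>auto simp: S_def\<close>)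
    qed
    then show ?thesis using H by (simp add: S_def DW)
  qed
  have "f \<notin> S"
  proof
    assume "f \<in> S"
    then have lim: "(\<lambda>n. nrm (R n f - T f) * nrm f) \<longlonglongrightarrow> 0"
      by (intro tendsto_mult_left_zero) (auto simp: S_def)
    have "- B (T f) f \<le> nrm (R n f - T f) * nrm f" for n
    proof -
      have "B (Y n f) f \<le> nrm f * nrm f"
        using Cauchy_Schwarz[of "Y n f" f] contr[OF f(1), of n] f(1)
          mult_right_mono[of "nrm (Y n f)" "nrm f" "nrm f"] by (simp add: D)
      then have "0 \<le> B (R n f) f"
        using f(1) by (simp add: R_def B_simps D nrm_square[symmetric] power2_eq_square)
      then have "- B (T f) f \<le> B (R n f - T f) f"
        using f(1) by (simp add: B_simps D)
      also have "\<dots> \<le> nrm (R n f - T f) * nrm f"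
        using Cauchy_Schwarz[of "R n f - T f" f] f(1) by (simp add: D)
      finally show ?thesis .
    qed
    then have "- B (T f) f \<le> 0"
      by (intro LIMSEQ_le_const[OF lim]) auto
    then show False using f by simp
  qed
  then show "\<exists>x\<in>H. x \<notin> S" using f by blast
  define G where "G n = R n g" for n
  have G: "G n \<in> H" for n using g by (simp add: G_def D)
  have diff: "nrm (G n - G m) \<le> (root_bound n - root_bound m) * nrm g" if "m \<le> n" for m n
    using nrm_root_defect_diff[OF K g(1) that] nrm_minus_commute[of "Y n g" "Y m g"] g
    by (simp add: G_def R_def Y_def[symmetric] D)
  obtain s where s: "s \<in> H" "(\<lambda>n. nrm (G n - s)) \<longlonglongrightarrow> 0"
  proof (rule completeD[OF G])
    fix e :: real assume e: "0 < e"
    have "Cauchy (\<lambda>n. root_bound n * nrm g)"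
      using root_bound_convergent by (intro convergent_Cauchy convergent_mult convergent_const)
    then obtain N where N: "\<And>m n. m \<ge> N \<Longrightarrow> n \<ge> N \<Longrightarrow> \<bar>root_bound m * nrm g - root_bound n * nrm g\<bar> < e"
      using e unfolding Cauchy_def dist_real_def by meson
    have "nrm (G m - G n) < e" if "m \<ge> N" "n \<ge> N" for m n
    proof (cases "n \<le> m")
      case True
      then show ?thesis using diff[OF True] N[OF that] by (simp add: algebra_simps)
    next
      case False
      then show ?thesis using diff[of m n] N[OF that(2,1)] nrm_minus_commute[OF G G, of m n]
        by (simp add: algebra_simps)
    qed
    then show "\<exists>N. \<forall>m\<ge>N. \<forall>n\<ge>N. nrm (G m - G n) < e" by blast
  qed
  \<comment> \<open>\<open>s\<close> plays the part of the modulus of \<open>T\<close> applied to \<open>g\<close>\<close>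
  define h where "h = s + T g"
  have h: "h \<in> H" using s g by (simp add: h_def D)
  have TK: "T (K x) = K (T x)" for x by (simp add: K_def D)
  have TY: "T (Y n x) = Y n (T x)" for n x
    unfolding Y_def by (rule root_defect_commute) (use D bounded_operatorD[OF K] TK in auto)
  have "h \<in> S"
  proof -
    have "(\<lambda>n. nrm (R n h - T h)) \<longlonglongrightarrow> 0"
    proof (rule tendsto_nrm_0I)
      show "R n h - T h \<in> H" for n using h by (simp add: D)
      show "nrm (R n h - T h) \<le> 3 * nrm (G n - s) + 2 * ((root_bound (Suc n) - root_bound n) * nrm g)" for n
      proof -
        define v where "v = G n - s"
        have v: "v \<in> H" using G s by (simp add: v_def)
        \<comment> \<open>the recursion turns \<open>R n (R n g) - T (T g)\<close> into twice an increment of the iteration, which vanishes in the limit\<close>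
        define u where "u = root_defect K (Suc n) g - Y n g"
        have u: "u \<in> H" "nrm u \<le> (root_bound (Suc n) - root_bound n) * nrm g"
          using nrm_root_defect_step[OF K g(1), of n] DY(2)[OF g(1)] DY(2)[OF g(1), of "Suc n"]
          unfolding u_def Y_def by (auto simp del: root_defect.simps)
        have "2 *\<^sub>R root_defect K (Suc n) g = g - T (T g) + Y n (Y n g)"
          by (simp add: Y_def K_def)
        then have "R n (R n g) - T (T g) = 2 *\<^sub>R u"
          by (simp add: u_def R_def D scaleR_diff_right scaleR_2[of "Y n g"] del: root_defect.simps)
        moreover have "R n (T g) = T (R n g)"
          by (simp add: R_def TY D)
        ultimately have "R n h - T h = 2 *\<^sub>R u - (R n v - T v)"
          by (simp add: h_def v_def G_def D algebra_simps)
        then have "nrm (R n h - T h) \<le> 2 * nrm u + (nrm (R n v) + nrm (T v))"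
          using nrm_triangle_diff[of "2 *\<^sub>R u" "R n v - T v"] nrm_triangle_diff[of "R n v" "T v"] u v
          by (simp add: D nrm_scaleR)
        then show ?thesis
          using DR(3)[OF v, of n] DT(3)[OF v] u by (simp add: v_def)
      qed
      obtain l where l: "root_bound \<longlonglongrightarrow> l"
        using root_bound_convergent by (auto simp: convergent_def)
      have "(\<lambda>n. root_bound (Suc n) - root_bound n) \<longlonglongrightarrow> 0"
        using tendsto_diff[OF LIMSEQ_Suc[OF l] l] by (simp del: root_bound.simps)
      then show "(\<lambda>n. 3 * nrm (G n - s) + 2 * ((root_bound (Suc n) - root_bound n) * nrm g)) \<longlonglongrightarrow> 0"
        by (intro tendsto_add_zero tendsto_mult_right_zero tendsto_mult_left_zero s(2))
    qed
    then show ?thesis using h by (simp add: S_def)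
  qed
  moreover have "nrm h \<noteq> 0"
  proof
    assume "nrm h = 0"
    then have hg: "B h g = 0" using B_eq_0_right[of g h] h g by (simp add: B_commute[of h g])
    have lim: "(\<lambda>n. nrm (G n - s) * nrm g) \<longlonglongrightarrow> 0"
      by (intro tendsto_mult_left_zero s(2))
    have "B (T g) g \<le> nrm (G n - s) * nrm g" for n
    proof -
      have "B (Y n g) g \<le> nrm g * nrm g"
        using Cauchy_Schwarz[of "Y n g" g] contr[OF g(1), of n] g(1)
          mult_right_mono[of "nrm (Y n g)" "nrm g" "nrm g"] by (simp add: D)
      then have "0 \<le> B (G n) g"
        using g(1) by (simp add: G_def R_def B_simps D nrm_square[symmetric] power2_eq_square)
      then have "B (T g) g \<le> B (G n - s) g"
        using hg g(1) s(1) G by (simp add: h_def B_simps D)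
      also have "\<dots> \<le> nrm (G n - s) * nrm g"
        using Cauchy_Schwarz[of "G n - s" g] g(1) G s by simp
      finally show ?thesis .
    qed
    then have "B (T g) g \<le> 0"
      by (intro LIMSEQ_le_const[OF lim]) auto
    then show False using g by simp
  qed
  ultimately show "\<exists>x\<in>S. nrm x \<noteq> 0" by blast
qed

text \<open>
  The symmetric operator \<open>T - t\<close> has zero quadratic form; polarising at \<open>x\<close> and \<open>y = (T - t) x\<close>
  gives \<open>\<parallel>y\<parallel>\<^sup>2 = 0\<close>.
\<close>

lemma symmetric_form_scalar:
  assumes T: "bounded_operator b T" "symmetric T"
    and form: "\<And>x. x \<in> H \<Longrightarrow> B (T x) x = t * B x x" and x: "x \<in> H"
  shows "nrm (T x - t *\<^sub>R x) = 0"
proof -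
  note D = bounded_operatorD[OF T(1)]
  define y where "y = T x - t *\<^sub>R x"
  have y: "y \<in> H" using x by (simp add: y_def D)
  have "B (T (x + y)) (x + y) = t * B (x + y) (x + y)"
    using form x y by simp
  moreover have "B (T y) x = B (T x) y"
    using T(2) x y B_commute[of y "T x"] by (simp add: symmetric_def D)
  ultimately have "B (T x) y - t * B x y = 0"
    using form[OF x] form[OF y] x y by (simp add: D B_simps B_commute[of y x] algebra_simps)
  then have "B y y = 0"
    unfolding y_def using x B_commute[of x "T x"] by (simp add: D B_simps algebra_simps)
  then show ?thesis
    by (simp add: nrm_def y_def)
qed

text \<open>
  If no number \<open>t\<close> lay strictly between two values of the Rayleigh quotient of \<open>T\<close>, the quotient would be
  constant and \<open>T\<close> a scalar. So some shift \<open>T - t\<close> has a form of both signs, and a small multiple of it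
  is a contraction with the same commutant.
\<close>

lemma symmetric_invariant_subspace:
  assumes T: "bounded_operator b T" "symmetric T"
    and nonscalar: "\<And>t. \<exists>x\<in>H. nrm (T x - t *\<^sub>R x) \<noteq> 0"
  obtains S where "closed_subspace S" "\<exists>x\<in>S. nrm x \<noteq> 0" "\<exists>x\<in>H. x \<notin> S"
    "\<And>W c x. bounded_operator c W \<Longrightarrow> (\<And>x. x \<in> H \<Longrightarrow> nrm (W (T x) - T (W x)) = 0) \<Longrightarrow> x \<in> S \<Longrightarrow> W x \<in> S"
proof -
  note D = bounded_operatorD[OF T(1)]
  have null: "B (T x) x = 0" if "x \<in> H" "B x x = 0" for x
    using Cauchy_Schwarz[of "T x" x] that by (simp add: D nrm_def)
  have "\<exists>t. \<exists>f\<in>H. \<exists>g\<in>H. B (T f) f < t * B f f \<and> t * B g g < B (T g) g"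
  proof (rule ccontr)
    assume neg: "\<not> ?thesis"
    define q where "q x = B (T x) x / B x x" for x
    have q: "q x = q y" if "x \<in> H" "y \<in> H" "0 < B x x" "0 < B y y" for x y
    proof -
      have le: "\<not> q x < q y" if "x \<in> H" "y \<in> H" "0 < B x x" "0 < B y y" for x y
      proof
        assume "q x < q y"
        then have "q x < (q x + q y) / 2" "(q x + q y) / 2 < q y" by auto
        then have "B (T x) x < (q x + q y) / 2 * B x x" "(q x + q y) / 2 * B y y < B (T y) y"
          using that unfolding q_def by (metis pos_divide_less_eq, metis pos_less_divide_eq)
        then show False using neg that by blast
      qed
      then show ?thesis using that by (meson linorder_cases)
    qed
    obtain t where t: "\<And>x. x \<in> H \<Longrightarrow> 0 < B x x \<Longrightarrow> q x = t"
      using q by metis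
    have "B (T x) x = t * B x x" if "x \<in> H" for x
    proof (cases "B x x = 0")
      case True
      then show ?thesis using null that by simp
    next
      case False
      then show ?thesis using t[OF that] B_nonneg[OF that] by (simp add: q_def field_simps)
    qed
    from symmetric_form_scalar[OF T this] nonscalar[of t] show False by blast
  qed
  then obtain t f g where f: "f \<in> H" "B (T f) f < t * B f f" and g: "g \<in> H" "t * B g g < B (T g) g"
    by blast
  \<comment> \<open>the summand \<open>1\<close> avoids division by zero when \<open>b = t = 0\<close>\<close>
  define c where "c = 1 / (\<bar>b\<bar> + \<bar>t\<bar> + 1)"
  have c: "0 < c" by (simp add: c_def)
  define T' where "T' x = c *\<^sub>R (T x - t *\<^sub>R x)" for x
  have T': "bounded_operator 1 T'"
    unfolding bounded_operator_def
  proof (intro conjI ballI)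
    show "linear T'"
      unfolding T'_def by (rule linearI) (simp_all add: D algebra_simps)
    fix x assume x: "x \<in> H"
    then show "T' x \<in> H" by (simp add: T'_def D)
    have "nrm (T x - t *\<^sub>R x) \<le> b * nrm x + \<bar>t\<bar> * nrm x"
      using nrm_triangle_diff[of "T x" "t *\<^sub>R x"] x D(3)[OF x] by (simp add: nrm_scaleR D(2))
    also have "\<dots> \<le> (\<bar>b\<bar> + \<bar>t\<bar> + 1) * nrm x"
      using nrm_nonneg[OF x] unfolding distrib_right[symmetric] by (intro mult_right_mono) auto
    finally show "nrm (T' x) \<le> 1 * nrm x"
      using x unfolding T'_def by (simp add: nrm_scaleR c_def D(2) pos_divide_le_eq mult.commute)
  qed
  moreover have "symmetric T'"
    using T(2) by (simp add: symmetric_def T'_def B_simps D)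
  moreover have "B (T' f) f < 0"
    using f c by (simp add: T'_def B_simps D mult_pos_neg)
  moreover have "0 < B (T' g) g"
    using g c by (simp add: T'_def B_simps D)
  ultimately obtain S where S: "closed_subspace S" "\<exists>x\<in>S. nrm x \<noteq> 0" "\<exists>x\<in>H. x \<notin> S"
    and inv: "\<And>W c x. bounded_operator c W \<Longrightarrow> (\<And>x. x \<in> H \<Longrightarrow> nrm (W (T' x) - T' (W x)) = 0)
      \<Longrightarrow> x \<in> S \<Longrightarrow> W x \<in> S"
    using symmetric_contraction_invariant_subspace[of T' f g] f g by blast
  show thesis
  proof (rule that[OF S])
    fix W k x assume W: "bounded_operator k W" and comm: "\<And>x. x \<in> H \<Longrightarrow> nrm (W (T x) - T (W x)) = 0"
      and x: "x \<in> S"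
    note DW = bounded_operatorD[OF W]
    show "W x \<in> S"
    proof (rule inv[OF W _ x])
      fix y assume y: "y \<in> H"
      have "W (T' y) - T' (W y) = c *\<^sub>R (W (T y) - T (W y))"
        by (simp add: T'_def DW algebra_simps)
      then show "nrm (W (T' y) - T' (W y)) = 0"
        using comm[OF y] y by (simp add: nrm_scaleR D DW)
    qed
  qed
qed

end

section \<open>Invariant subspaces of isometries\<close>

context semi_hilbert
begin

lemma isometry_preserves_form:
  assumes U: "linear U" "\<And>x. x \<in> H \<Longrightarrow> U x \<in> H" "\<And>x. x \<in> H \<Longrightarrow> nrm (U x) = nrm x"
    and x: "x \<in> H" and y: "y \<in> H"
  shows "B (U x) (U y) = B x y"
proof -
  have sq: "B (U z) (U z) = B z z" if "z \<in> H" for z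
    using U(2,3)[OF that] that by (metis nrm_square)
  have "B (U x + U y) (U x + U y) = B (x + y) (x + y)"
    using sq[of "x + y"] x y U(1) by (simp add: linear_add)
  then show ?thesis
    using sq[OF x] sq[OF y] x y by (simp add: B_simps U B_commute[of "U y" "U x"] B_commute[of y x])
qed

text \<open>
  A preimage of each basis vector of \<open>H\<close> is chosen and the choice is extended linearly. Choosing preimages
  vector by vector would give an inverse that is linear up to null vectors only.
\<close>

lemma surjective_isometry_inverse:
  assumes U: "linear U" "\<And>x. x \<in> H \<Longrightarrow> U x \<in> H" "\<And>x. x \<in> H \<Longrightarrow> nrm (U x) = nrm x"
    and onto: "\<And>y. y \<in> H \<Longrightarrow> \<exists>x\<in>H. nrm (U x - y) = 0"
  obtains V where "linear V" "\<And>x. x \<in> H \<Longrightarrow> V x \<in> H"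
    "\<And>x. x \<in> H \<Longrightarrow> nrm (V x) = nrm x" "\<And>x. x \<in> H \<Longrightarrow> nrm (U (V x) - x) = 0"
    "\<And>x. x \<in> H \<Longrightarrow> nrm (V (U x) - x) = 0"
proof -
  obtain A where A: "A \<subseteq> H" "independent A" "H \<subseteq> span A"
    using maximal_independent_subset[of H] by blast
  obtain pre where pre: "\<And>y. y \<in> H \<Longrightarrow> pre y \<in> H \<and> nrm (U (pre y) - y) = 0"
    using onto by metis
  obtain V where V: "linear V" "\<And>y. y \<in> A \<Longrightarrow> V y = pre y"
    using linear_independent_extend[OF A(2)] by blast
  have sub: "subspace {y \<in> H. V y \<in> H \<and> nrm (U (V y) - y) = 0}"
    unfolding subspace_def
  proof (intro conjI ballI allI)
    show "0 \<in> {y \<in> H. V y \<in> H \<and> nrm (U (V y) - y) = 0}"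
      using U V by (simp add: linear_0)
  next
    fix x y assume x: "x \<in> {y \<in> H. V y \<in> H \<and> nrm (U (V y) - y) = 0}"
      and y: "y \<in> {y \<in> H. V y \<in> H \<and> nrm (U (V y) - y) = 0}"
    have eq: "U (V (x + y)) - (x + y) = (U (V x) - x) + (U (V y) - y)"
      using U V by (simp add: linear_add)
    have "nrm (U (V (x + y)) - (x + y)) \<le> 0"
      unfolding eq using nrm_triangle[of "U (V x) - x" "U (V y) - y"] x y U(2) by simp
    then show "x + y \<in> {y \<in> H. V y \<in> H \<and> nrm (U (V y) - y) = 0}"
      using x y U(2) V by (auto simp: linear_add nrm_le_0_iff)
  next
    fix r x assume x: "x \<in> {y \<in> H. V y \<in> H \<and> nrm (U (V y) - y) = 0}"
    have "U (V (r *\<^sub>R x)) - r *\<^sub>R x = r *\<^sub>R (U (V x) - x)"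
      using U V by (simp add: linear_scale scaleR_diff_right)
    then show "r *\<^sub>R x \<in> {y \<in> H. V y \<in> H \<and> nrm (U (V y) - y) = 0}"
      using x U(2) V by (auto simp: linear_scale nrm_scaleR)
  qed
  have "A \<subseteq> {y \<in> H. V y \<in> H \<and> nrm (U (V y) - y) = 0}"
    using A(1) V(2) pre by auto
  then have V': "V y \<in> H" "nrm (U (V y) - y) = 0" if "y \<in> H" for y
    using span_minimal[OF _ sub, of A] A(3) that by blast+
  have V_iso: "nrm (V x) = nrm x" if "x \<in> H" for x
    using nrm_cong[of "U (V x)" x] V'[OF that] that U(2,3) by simp
  have "nrm (V (U x) - x) = 0" if "x \<in> H" for x
  proof -
    have "nrm (V (U x) - x) = nrm (U (V (U x) - x))"
      using V' U that by simp
    then show ?thesis using V'(2)[of "U x"] U that by (simp add: linear_diff)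
  qed
  from that[OF V(1) V'(1) V_iso V'(2) this] show thesis .
qed

text \<open>
  An isometry that is not onto has its range as an invariant subspace, which is closed because a
  convergent sequence of images comes from a Cauchy sequence. A surjective one has an inverse \<open>V\<close> that is
  also its adjoint, so \<open>P = U + V\<close> and \<open>Q = J (U - V)\<close> are symmetric, and both commute with \<open>U\<close> and \<open>J\<close> up to
  null vectors. They determine \<open>U\<close> by \<open>2 U = P - J Q\<close>, so they are not both real scalars.
\<close>

lemma nonscalar_isometry_invariant_subspace:
  assumes U: "linear U" "\<And>x. x \<in> H \<Longrightarrow> U x \<in> H" "\<And>x. x \<in> H \<Longrightarrow> nrm (U x) = nrm x"
    and J: "linear J" "\<And>x. x \<in> H \<Longrightarrow> J x \<in> H" "\<And>x. x \<in> H \<Longrightarrow> nrm (J x) = nrm x"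
      "\<And>x. J (J x) = - x"
    and UJ: "\<And>x. U (J x) = J (U x)"
    and nonscalar: "\<And>a b. \<exists>x\<in>H. nrm (U x - (a *\<^sub>R x + b *\<^sub>R J x)) \<noteq> 0"
  obtains S where "closed_subspace S" "\<exists>x\<in>S. nrm x \<noteq> 0" "\<exists>x\<in>H. x \<notin> S"
    "\<And>x. x \<in> S \<Longrightarrow> U x \<in> S" "\<And>x. x \<in> S \<Longrightarrow> J x \<in> S"
proof -
  have oU: "bounded_operator 1 U" and oJ: "bounded_operator 1 J"
    using U J by (auto simp: bounded_operator_def)
  note D = bounded_operatorD[OF oU] bounded_operatorD[OF oJ]
  show thesis
  proof (cases "\<forall>y\<in>H. \<exists>x\<in>H. nrm (U x - y) = 0")
    case False
    define S where "S = {y\<in>H. \<exists>x\<in>H. nrm (U x - y) = 0}"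
    have US: "U x \<in> S" if "x \<in> H" for x
      using that by (auto simp: S_def D intro!: bexI[of _ x])
    have cs: "closed_subspace S"
      unfolding closed_subspace_def subspace_def
    proof (intro conjI ballI allI impI)
      show "S \<subseteq> H" by (auto simp: S_def)
      show "0 \<in> S" using US[of 0] by (simp add: D)
    next
      fix x y assume "x \<in> S" "y \<in> S"
      then obtain x' y' where xy: "x \<in> H" "x' \<in> H" "nrm (U x' - x) = 0" "y \<in> H" "y' \<in> H" "nrm (U y' - y) = 0"
        by (auto simp: S_def)
      have "nrm (U (x' + y') - (x + y)) \<le> 0"
        using nrm_triangle[of "U x' - x" "U y' - y"] xy by (simp add: D algebra_simps)
      then show "x + y \<in> S"
        unfolding S_def using xy by (auto simp: nrm_le_0_iff D intro!: bexI[of _ "x' + y'"])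
    next
      fix r x assume "x \<in> S"
      then obtain x' where x: "x \<in> H" "x' \<in> H" "nrm (U x' - x) = 0"
        by (auto simp: S_def)
      have "nrm (U (r *\<^sub>R x') - r *\<^sub>R x) = 0"
        using x by (simp add: D nrm_scaleR flip: scaleR_diff_right)
      then show "r *\<^sub>R x \<in> S"
        unfolding S_def using x by (auto intro!: bexI[of _ "r *\<^sub>R x'"])
    next
      fix F x assume "(\<forall>n. F n \<in> S) \<and> x \<in> H \<and> (\<lambda>n. nrm (F n - x)) \<longlonglongrightarrow> 0"
      then have F: "\<And>n. F n \<in> S" and x: "x \<in> H" and lim: "(\<lambda>n. nrm (F n - x)) \<longlonglongrightarrow> 0" by auto
      have "\<forall>n. \<exists>z. z \<in> H \<and> nrm (U z - F n) = 0" and FH: "F n \<in> H" for n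
        using F by (auto simp: S_def)
      then obtain G where G: "\<And>n. G n \<in> H" "\<And>n. nrm (U (G n) - F n) = 0"
        by metis
      have UG: "nrm (U (G n) - z) \<le> nrm (F n - z)" if "z \<in> H" for n z
        using nrm_triangle[of "U (G n) - F n" "F n - z"] G FH that by (simp add: D)
      obtain g where g: "g \<in> H" "(\<lambda>n. nrm (G n - g)) \<longlonglongrightarrow> 0"
      proof (rule completeD[OF G(1)])
        fix e :: real assume "0 < e"
        then obtain N where N: "\<And>n. n \<ge> N \<Longrightarrow> nrm (F n - x) < e / 2"
          using tendsto_nrm_0D[OF lim, of "e / 2"] by auto
        have "nrm (G m - G n) < e" if "m \<ge> N" "n \<ge> N" for m n
        proof -
          have "nrm (G m - G n) = nrm (U (G m) - U (G n))"
            using U(3)[of "G m - G n"] G by (simp add: D)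
          also have "\<dots> \<le> nrm (U (G m) - x) + nrm (U (G n) - x)"
            using nrm_triangle_diff[of "U (G m) - x" "U (G n) - x"] G x by (simp add: D)
          also have "\<dots> \<le> nrm (F m - x) + nrm (F n - x)"
            using UG[OF x] by (intro add_mono)
          also have "\<dots> < e" using N[OF that(1)] N[OF that(2)] by linarith
          finally show ?thesis .
        qed
        then show "\<exists>N. \<forall>m\<ge>N. \<forall>n\<ge>N. nrm (G m - G n) < e" by blast
      qed
      have "nrm (U g - x) \<le> nrm (G n - g) + nrm (F n - x)" for n
      proof -
        have "nrm (U g - x) \<le> nrm (U (G n) - x) + nrm (U (G n - g))"
          using nrm_triangle_diff[of "U (G n) - x" "U (G n - g)"] G g(1) x by (simp add: D)
        then show ?thesis using UG[OF x, of n] U(3)[of "G n - g"] G g(1) by simp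
      qed
      then have "nrm (U g - x) \<le> 0"
        by (intro LIMSEQ_le_const[OF tendsto_add_zero[OF g(2) lim]]) auto
      then show "x \<in> S"
        unfolding S_def using x g(1) by (auto simp: nrm_le_0_iff D)
    qed
    obtain z where z: "z \<in> H" "nrm z \<noteq> 0" using nonscalar[of 0 0] U by auto
    show thesis
    proof (rule that[OF cs])
      show "\<exists>x\<in>S. nrm x \<noteq> 0" using US[OF z(1)] U(3)[OF z(1)] z by (intro bexI[of _ "U z"]) simp_all
      show "\<exists>x\<in>H. x \<notin> S" using False by (auto simp: S_def)
      show "U x \<in> S" if "x \<in> S" for x using that by (intro US) (simp add: S_def)
      show "J y \<in> S" if y: "y \<in> S" for y
      proof -
        obtain x where x: "x \<in> H" "nrm (U x - y) = 0" "y \<in> H" using y by (auto simp: S_def)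
        have "nrm (U (J x) - J y) = nrm (J (U x - y))" by (simp add: UJ D)
        then show ?thesis
          unfolding S_def using x J(3)[of "U x - y"] by (auto simp: D intro!: bexI[of _ "J x"])
      qed
    qed
  next
    case True
    then obtain V where V: "linear V" "\<And>x. x \<in> H \<Longrightarrow> V x \<in> H" "\<And>x. x \<in> H \<Longrightarrow> nrm (V x) = nrm x"
      and UV: "\<And>x. x \<in> H \<Longrightarrow> nrm (U (V x) - x) = 0" and VU: "\<And>x. x \<in> H \<Longrightarrow> nrm (V (U x) - x) = 0"
      using surjective_isometry_inverse[OF U] by metis
    have oV: "bounded_operator 1 V" using V by (auto simp: bounded_operator_def)
    note D = D bounded_operatorD[OF oV]
    have adj: "B (U x) y = B x (V y)" if "x \<in> H" "y \<in> H" for x y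
      using isometry_preserves_form[OF U, of x "V y"] B_cong_right[of "U x" "U (V y)" y] that UV
      by (simp add: D)
    have adj': "B (V x) y = B x (U y)" if "x \<in> H" "y \<in> H" for x y
      using adj[OF that(2,1)] that B_commute[of "V x" y] B_commute[of x "U y"] by (simp add: D)
    have skew: "B (J x) y = - B x (J y)" if "x \<in> H" "y \<in> H" for x y
      using isometry_preserves_form[OF J(1-3), of "J x" y] that by (simp add: J(4) B_minus D)
    have VJ: "nrm (V (J x) - J (V x)) = 0" if x: "x \<in> H" for x
    proof -
      have "nrm (J (U (V x)) - J x) = 0"
        using bounded_operator_null[OF oJ, of "U (V x) - x"] UV x by (simp add: D)
      then have "nrm (J x - J (U (V x))) = 0"
        using x nrm_minus_commute[of "J x" "J (U (V x))"] by (simp add: D)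
      then have "nrm (U (V (J x)) - J (U (V x))) = 0"
        using nrm_eq_0_trans[of "U (V (J x))" "J x" "J (U (V x))"] UV x by (simp add: D)
      moreover have "nrm (V (J x) - J (V x)) = nrm (U (V (J x) - J (V x)))"
        using U(3)[of "V (J x) - J (V x)"] x by (simp add: D)
      ultimately show ?thesis by (simp add: D UJ)
    qed
    have comm: "nrm (U (V x) - V (U x)) = 0" if x: "x \<in> H" for x
      using nrm_eq_0_trans[of "U (V x)" x "V (U x)"] UV[OF x] VU[OF x] x nrm_minus_commute[of x "V (U x)"]
      by (simp add: D)
    define P where "P x = U x + V x" for x
    define Q where "Q x = J (U x - V x)" for x
    have P: "bounded_operator 2 P" "symmetric P"
    proof -
      have "nrm (U x + V x) \<le> 2 * nrm x" if "x \<in> H" for x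
        using nrm_triangle[of "U x" "V x"] U V that by simp
      moreover have "linear P"
        unfolding P_def by (rule linearI) (simp_all add: D algebra_simps)
      ultimately show "bounded_operator 2 P" by (auto simp: bounded_operator_def P_def D)
      show "symmetric P"
        unfolding symmetric_def P_def by (auto simp: B_simps D adj adj')
    qed
    have Q: "bounded_operator 2 Q" "symmetric Q"
    proof -
      have "nrm (Q x) \<le> 2 * nrm x" if "x \<in> H" for x
        using nrm_triangle_diff[of "U x" "V x"] U V J(3)[of "U x - V x"] that by (simp add: Q_def)
      moreover have "linear Q"
        unfolding Q_def by (rule linearI) (simp_all add: D algebra_simps)
      ultimately show "bounded_operator 2 Q" by (auto simp: bounded_operator_def Q_def D)
      have "B (Q x) y = B x (Q y)" if x: "x \<in> H" and y: "y \<in> H" for x y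
      proof -
        have "B (Q x) y = - (B (U x) (J y) - B (V x) (J y))"
          using x y by (simp add: Q_def skew D B_simps)
        also have "\<dots> = - (B x (V (J y)) - B x (U (J y)))"
          using x y by (simp add: adj adj' D)
        also have "B x (V (J y)) = B x (J (V y))"
          using B_cong_right[of x "V (J y)" "J (V y)"] VJ[OF y] x y by (simp add: D)
        also have "- (B x (J (V y)) - B x (U (J y))) = B x (Q y)"
          using x y by (simp add: Q_def UJ D B_simps)
        finally show ?thesis .
      qed
      then show "symmetric Q" by (simp add: symmetric_def)
    qed
    \<comment> \<open>whichever of \<open>P\<close> and \<open>Q\<close> is not a real scalar\<close>
    have "\<exists>T b. bounded_operator b T \<and> symmetric T \<and> (\<forall>t. \<exists>x\<in>H. nrm (T x - t *\<^sub>R x) \<noteq> 0) \<and>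
        (\<forall>x\<in>H. nrm (U (T x) - T (U x)) = 0) \<and> (\<forall>x\<in>H. nrm (J (T x) - T (J x)) = 0)"
    proof (cases "\<exists>t. \<forall>x\<in>H. nrm (P x - t *\<^sub>R x) = 0")
      case False
      have "nrm (U (P x) - P (U x)) = 0" "nrm (J (P x) - P (J x)) = 0" if x: "x \<in> H" for x
        using comm[OF x] VJ[OF x] nrm_minus_commute[of "V (J x)" "J (V x)"] x
        by (simp_all add: P_def D UJ)
      with False P show ?thesis by blast
    next
      case True
      then obtain s where s: "\<And>x. x \<in> H \<Longrightarrow> nrm (P x - s *\<^sub>R x) = 0" by blast
      have "\<exists>x\<in>H. nrm (Q x - t *\<^sub>R x) \<noteq> 0" for t
      proof (rule ccontr)
        assume "\<not> ?thesis"
        then have t: "\<And>x. x \<in> H \<Longrightarrow> nrm (Q x - t *\<^sub>R x) = 0" by blast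
        have "nrm (U x - ((s/2) *\<^sub>R x + (- t/2) *\<^sub>R J x)) = 0" if x: "x \<in> H" for x
        proof -
          define v where "v = U x - ((s/2) *\<^sub>R x + (- t/2) *\<^sub>R J x)"
          have "J (Q x - t *\<^sub>R x) = V x - U x - t *\<^sub>R J x"
            by (simp add: Q_def D J(4))
          then have "2 *\<^sub>R v = (P x - s *\<^sub>R x) - J (Q x - t *\<^sub>R x)"
            by (simp add: v_def P_def algebra_simps scaleR_2)
          moreover have "nrm ((P x - s *\<^sub>R x) - J (Q x - t *\<^sub>R x)) \<le> 0"
            using nrm_triangle_diff[of "P x - s *\<^sub>R x" "J (Q x - t *\<^sub>R x)"] s[OF x] x
              bounded_operator_null[OF oJ _ t[OF x]] bounded_operatorD(2)[OF P(1) x] bounded_operatorD(2)[OF Q(1) x] J(2) by simp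
          ultimately have "nrm (2 *\<^sub>R v) \<le> 0" by simp
          then show ?thesis
            using x by (simp add: v_def[symmetric] nrm_scaleR nrm_le_0_iff)
              (simp add: v_def D nrm_scaleR nrm_le_0_iff)
        qed
        with nonscalar show False by blast
      qed
      moreover have "nrm (U (Q x) - Q (U x)) = 0" if x: "x \<in> H" for x
      proof -
        have "U (Q x) - Q (U x) = - J (U (V x) - V (U x))"
          by (simp add: Q_def UJ D)
        then show ?thesis
          using bounded_operator_null[OF oJ _ comm[OF x]] x nrm_minus_commute[of "J (V (U x))" "J (U (V x))"]
          by (simp add: D)
      qed
      moreover have "nrm (J (Q x) - Q (J x)) = 0" if x: "x \<in> H" for x
      proof -
        have "J (Q x) - Q (J x) = J (V (J x) - J (V x))"
          by (simp add: Q_def UJ D)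
        then show ?thesis
          using bounded_operator_null[OF oJ _ VJ[OF x]] x by (simp only: D H_closed)
      qed
      ultimately show ?thesis using Q by blast
    qed
    then obtain T b where T: "bounded_operator b T" "symmetric T" "\<And>t. \<exists>x\<in>H. nrm (T x - t *\<^sub>R x) \<noteq> 0"
      and TU: "\<And>x. x \<in> H \<Longrightarrow> nrm (U (T x) - T (U x)) = 0"
      and TJ: "\<And>x. x \<in> H \<Longrightarrow> nrm (J (T x) - T (J x)) = 0"
      by blast
    from symmetric_invariant_subspace[OF T] obtain S where S: "closed_subspace S" "\<exists>x\<in>S. nrm x \<noteq> 0" "\<exists>x\<in>H. x \<notin> S"
      and inv: "\<And>W c x. bounded_operator c W \<Longrightarrow> (\<And>x. x \<in> H \<Longrightarrow> nrm (W (T x) - T (W x)) = 0) \<Longrightarrow> x \<in> S \<Longrightarrow> W x \<in> S"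
      by blast
    show thesis
      by (rule that[OF S]) (use inv[OF oU TU] inv[OF oJ TJ] in blast)+
  qed
qed

lemma closed_subspace_null:
  assumes "closed_subspace S" "x \<in> S" "y \<in> H" "nrm (x - y) = 0"
  shows "y \<in> S"
proof -
  have "(\<lambda>n. nrm (x - y)) \<longlonglongrightarrow> 0" by (simp add: assms(4))
  then show ?thesis
    using assms(1-3) unfolding closed_subspace_def by (elim conjE allE[of _ "\<lambda>n. x"] allE[of _ y]) simp
qed

text \<open>
  Orthogonality to \<open>f\<close> and to \<open>J f\<close> in the real form is orthogonality to \<open>f\<close> in the complex inner product.
  The component of \<open>g\<close> orthogonal to \<open>f\<close> shows that this complement is not null.
\<close>

lemma scalar_invariant_subspace:
  assumes J: "linear J" "\<And>x. x \<in> H \<Longrightarrow> J x \<in> H" "\<And>x. x \<in> H \<Longrightarrow> nrm (J x) = nrm x"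
      "\<And>x. J (J x) = - x"
    and U: "\<And>x. x \<in> H \<Longrightarrow> U x \<in> H" "\<And>x. x \<in> H \<Longrightarrow> nrm (U x - (a *\<^sub>R x + b *\<^sub>R J x)) = 0"
    and f: "f \<in> H" "nrm f \<noteq> 0" and g: "g \<in> H" "\<And>a b. nrm (g - (a *\<^sub>R f + b *\<^sub>R J f)) \<noteq> 0"
  obtains S where "closed_subspace S" "\<exists>x\<in>S. nrm x \<noteq> 0" "\<exists>x\<in>H. x \<notin> S"
    "\<And>x. x \<in> S \<Longrightarrow> U x \<in> S" "\<And>x. x \<in> S \<Longrightarrow> J x \<in> S"
proof -
  have oJ: "bounded_operator 1 J" using J by (auto simp: bounded_operator_def)
  note D = bounded_operatorD[OF oJ]
  have skew: "B (J x) y = - B x (J y)" if "x \<in> H" "y \<in> H" for x y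
    using isometry_preserves_form[OF J(1-3), of "J x" y] that by (simp add: J(4) B_minus D)
  define S where "S = {x\<in>H. B x f = 0 \<and> B x (J f) = 0}"
  have cs: "closed_subspace S"
    unfolding closed_subspace_def
  proof (intro conjI allI impI)
    show "S \<subseteq> H" by (auto simp: S_def)
    have "B 0 y = 0" if "y \<in> H" for y using B_scaleR[of 0 y 0] that by simp
    then show "subspace S"
      unfolding subspace_def using f by (auto simp: S_def B_simps D)
    fix F x assume *: "(\<forall>n. F n \<in> S) \<and> x \<in> H \<and> (\<lambda>n. nrm (F n - x)) \<longlonglongrightarrow> 0"
    have "B x y = 0" if y: "y \<in> H" and 0: "\<And>n. B (F n) y = 0" for y
    proof -
      have "\<bar>B x y\<bar> \<le> nrm (F n - x) * nrm y" for n
        using Cauchy_Schwarz[of "F n - x" y] * y 0[of n] by (simp add: B_simps S_def)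
      moreover have "(\<lambda>n. nrm (F n - x) * nrm y) \<longlonglongrightarrow> 0"
        using * by (intro tendsto_mult_left_zero) simp
      ultimately have "\<bar>B x y\<bar> \<le> 0"
        by (intro LIMSEQ_le_const[where X = "\<lambda>n. nrm (F n - x) * nrm y"]) auto
      then show ?thesis by simp
    qed
    then show "x \<in> S" using * f by (auto simp: S_def D)
  qed
  have JS: "J x \<in> S" if "x \<in> S" for x
    using that f by (auto simp: S_def skew D J(4) B_minus_right)
  have US: "U x \<in> S" if x: "x \<in> S" for x
  proof (rule closed_subspace_null[OF cs])
    have H: "x \<in> H" using x by (simp add: S_def)
    show "a *\<^sub>R x + b *\<^sub>R J x \<in> S"
      using x JS[OF x] cs subspace_add subspace_scale unfolding closed_subspace_def by blast
    show "nrm (a *\<^sub>R x + b *\<^sub>R J x - U x) = 0"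
      using U(1)[OF H] U(2)[OF H] H nrm_minus_commute[of "U x" "a *\<^sub>R x + b *\<^sub>R J x"]
      by (simp add: D)
    show "U x \<in> H" by (rule U(1)[OF H])
  qed
  have ff: "B f f \<noteq> 0" using f by (simp add: nrm_def)
  have JfJf: "B (J f) (J f) = B f f"
    using isometry_preserves_form[OF J(1-3)] f by simp
  have fJf: "B (J f) f = 0" "B f (J f) = 0"
    using skew[of f f] f B_commute[of f "J f"] by (simp_all add: D)
  \<comment> \<open>the coefficients are the real and imaginary part of the complex projection coefficient\<close>
  define v where "v = g - ((B g f / B f f) *\<^sub>R f + (B g (J f) / B f f) *\<^sub>R J f)"
  have "v \<in> S"
    using f g ff by (simp add: v_def S_def B_simps D fJf JfJf)
  moreover have "nrm v \<noteq> 0" unfolding v_def by (rule g)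
  ultimately have 1: "\<exists>x\<in>S. nrm x \<noteq> 0" by (rule bexI[rotated])
  have "f \<notin> S" using ff by (simp add: S_def)
  then have 2: "\<exists>x\<in>H. x \<notin> S" using f(1) by (rule bexI)
  show thesis by (rule that[OF cs 1 2 US JS])
qed

lemma isometry_invariant_subspace:
  assumes U: "linear U" "\<And>x. x \<in> H \<Longrightarrow> U x \<in> H" "\<And>x. x \<in> H \<Longrightarrow> nrm (U x) = nrm x"
    and J: "linear J" "\<And>x. x \<in> H \<Longrightarrow> J x \<in> H" "\<And>x. x \<in> H \<Longrightarrow> nrm (J x) = nrm x"
      "\<And>x. J (J x) = - x"
    and UJ: "\<And>x. U (J x) = J (U x)"
    and f: "f \<in> H" "nrm f \<noteq> 0" and g: "g \<in> H" "\<And>a b. nrm (g - (a *\<^sub>R f + b *\<^sub>R J f)) \<noteq> 0"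
  obtains S where "closed_subspace S" "\<exists>x\<in>S. nrm x \<noteq> 0" "\<exists>x\<in>H. x \<notin> S"
    "\<And>x. x \<in> S \<Longrightarrow> U x \<in> S" "\<And>x. x \<in> S \<Longrightarrow> J x \<in> S"
proof (cases "\<forall>a b. \<exists>x\<in>H. nrm (U x - (a *\<^sub>R x + b *\<^sub>R J x)) \<noteq> 0")
  case True
  then have nonscalar: "\<And>a b. \<exists>x\<in>H. nrm (U x - (a *\<^sub>R x + b *\<^sub>R J x)) \<noteq> 0" by blast
  show thesis
  proof (rule nonscalar_isometry_invariant_subspace[OF U J UJ nonscalar])
    fix S assume "closed_subspace S" "\<exists>x\<in>S. nrm x \<noteq> 0" "\<exists>x\<in>H. x \<notin> S"
      "\<And>x. x \<in> S \<Longrightarrow> U x \<in> S" "\<And>x. x \<in> S \<Longrightarrow> J x \<in> S"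
    then show thesis by (rule that)
  qed
next
  case False
  then obtain a b where ab: "\<And>x. x \<in> H \<Longrightarrow> nrm (U x - (a *\<^sub>R x + b *\<^sub>R J x)) = 0" by blast
  show thesis
  proof (rule scalar_invariant_subspace[OF J U(2) ab f g])
    fix S assume "closed_subspace S" "\<exists>x\<in>S. nrm x \<noteq> 0" "\<exists>x\<in>H. x \<notin> S"
      "\<And>x. x \<in> S \<Longrightarrow> U x \<in> S" "\<And>x. x \<in> S \<Longrightarrow> J x \<in> S"
    then show thesis by (rule that)
  qed
qed

end

section \<open>The space of square-integrable functions\<close>

instantiation "fun" :: (type, real_vector) real_vector
begin

definition scaleR_fun_def: "scaleR r f = (\<lambda>x. r *\<^sub>R f x)"

instance
  by standard (simp_all add: scaleR_fun_def plus_fun_def algebra_simps)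

end

lemma scaleR_fun_apply [simp]: "(r *\<^sub>R f) x = r *\<^sub>R f x"
  by (simp add: scaleR_fun_def)

lemma l2_space_iff:
  "f \<in> l2_space M \<longleftrightarrow> f \<in> borel_measurable M \<and> (\<integral>\<^sup>+x. ennreal ((cmod (f x))\<^sup>2) \<partial>M) < \<infinity>"
  by (auto simp: l2_space_def integrable_iff_bounded)

lemma l2_space_measurable: "f \<in> l2_space M \<Longrightarrow> f \<in> borel_measurable M"
  by (simp add: l2_space_def)

lemma l2_norm_nonneg: "0 \<le> l2_norm M f"
  by (simp add: l2_norm_def)

lemma l2_norm_square: "(l2_norm M f)\<^sup>2 = (\<integral>x. (cmod (f x))\<^sup>2 \<partial>M)"
  by (simp add: l2_norm_def)

lemma nn_integral_l2_norm:
  "f \<in> l2_space M \<Longrightarrow> (\<integral>\<^sup>+x. ennreal ((cmod (f x))\<^sup>2) \<partial>M) = ennreal ((l2_norm M f)\<^sup>2)"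
  unfolding l2_norm_square by (intro nn_integral_eq_integral) (auto simp: l2_space_def)

lemma l2_norm_leI:
  assumes "f \<in> l2_space M" "(\<integral>\<^sup>+x. ennreal ((cmod (f x))\<^sup>2) \<partial>M) \<le> ennreal (c\<^sup>2)" "0 \<le> c"
  shows "l2_norm M f \<le> c"
  using assms by (simp add: nn_integral_l2_norm power2_le_iff_abs_le l2_norm_nonneg)

lemma l2_norm_cong_AE:
  assumes "f \<in> borel_measurable M" "g \<in> borel_measurable M" "AE x in M. f x = g x"
  shows "l2_norm M f = l2_norm M g"
  unfolding l2_norm_def
  by (intro arg_cong[of _ _ sqrt] integral_cong_AE) (use assms in auto)

lemma l2_norm_eq_0_iff:
  assumes "f \<in> l2_space M"
  shows "l2_norm M f = 0 \<longleftrightarrow> (AE x in M. f x = 0)"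
  using assms integral_nonneg_eq_0_iff_AE[of M "\<lambda>x. (cmod (f x))\<^sup>2"]
  by (simp add: l2_norm_def l2_space_def)

lemma l2_space_lincomb:
  assumes "f \<in> l2_space M" "g \<in> l2_space M"
  shows "(\<lambda>x. a * f x + b * g x) \<in> l2_space M"
proof -
  have [measurable]: "f \<in> borel_measurable M" "g \<in> borel_measurable M"
    using assms by (auto simp: l2_space_def)
  have "integrable M (\<lambda>x. (cmod (a * f x + b * g x))\<^sup>2)"
  proof (rule Bochner_Integration.integrable_bound)
    show "integrable M (\<lambda>x. 2 * (cmod a)\<^sup>2 * (cmod (f x))\<^sup>2 + 2 * (cmod b)\<^sup>2 * (cmod (g x))\<^sup>2)"
      using assms by (auto simp: l2_space_def)
    have "(cmod (u + v))\<^sup>2 \<le> 2 * (cmod u)\<^sup>2 + 2 * (cmod v)\<^sup>2" for u v :: complex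
    proof -
      have "(cmod (u + v))\<^sup>2 \<le> (cmod u + cmod v)\<^sup>2"
        by (intro power_mono norm_triangle_ineq) simp
      also have "\<dots> \<le> 2 * (cmod u)\<^sup>2 + 2 * (cmod v)\<^sup>2"
        using zero_le_power2[of "cmod u - cmod v"] by (simp add: power2_eq_square algebra_simps)
      finally show ?thesis .
    qed
    from this[of "a * f x" "b * g x" for x]
    show "AE x in M. norm ((cmod (a * f x + b * g x))\<^sup>2)
        \<le> norm (2 * (cmod a)\<^sup>2 * (cmod (f x))\<^sup>2 + 2 * (cmod b)\<^sup>2 * (cmod (g x))\<^sup>2)"
      by (simp add: norm_mult power_mult_distrib mult.assoc)
  qed measurable
  then show ?thesis by (simp add: l2_space_def)
qed

lemma l2_space_zero: "(\<lambda>x. 0) \<in> l2_space M"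
  by (simp add: l2_space_def)

lemma l2_space_add: "f \<in> l2_space M \<Longrightarrow> g \<in> l2_space M \<Longrightarrow> f + g \<in> l2_space M"
  using l2_space_lincomb[of f M g 1 1] by (simp add: plus_fun_def)

lemma l2_space_diff: "f \<in> l2_space M \<Longrightarrow> g \<in> l2_space M \<Longrightarrow> f - g \<in> l2_space M"
  using l2_space_lincomb[of f M g 1 "-1"] by (simp add: fun_diff_def)

lemma l2_space_mult: "f \<in> l2_space M \<Longrightarrow> (\<lambda>x. c * f x) \<in> l2_space M"
  using l2_space_lincomb[of f M f c 0] by simp

lemma integrable_l2_inner:
  assumes "f \<in> l2_space M" "g \<in> l2_space M"
  shows "integrable M (\<lambda>x. f x * cnj (g x))"
proof (rule Bochner_Integration.integrable_bound)
  show "integrable M (\<lambda>x. (cmod (f x))\<^sup>2 + (cmod (g x))\<^sup>2)"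
    using assms by (auto simp: l2_space_def)
  have "cnj \<in> borel_measurable borel"
    by (intro borel_measurable_continuous_onI continuous_intros)
  then show "(\<lambda>x. f x * cnj (g x)) \<in> borel_measurable M"
    using assms by (auto simp: l2_space_def intro!: borel_measurable_times intro: measurable_compose)
  have "cmod u * cmod v \<le> (cmod u)\<^sup>2 + (cmod v)\<^sup>2" for u v :: complex
    using zero_le_power2[of "cmod u - cmod v"] mult_nonneg_nonneg[OF norm_ge_zero[of u] norm_ge_zero[of v]]
    unfolding power2_diff by linarith
  then show "AE x in M. norm (f x * cnj (g x)) \<le> norm ((cmod (f x))\<^sup>2 + (cmod (g x))\<^sup>2)"
    by (simp add: norm_mult)
qed

text \<open>
  Riesz-Fischer for exponent two. Along a subsequence with increments \<open>\<parallel>D k\<parallel> < 2\<^sup>-\<^sup>k\<close> the function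
  \<open>\<Sum>k. 2\<^sup>k \<bar>D k\<bar>\<^sup>2\<close> is integrable, hence finite almost everywhere; since \<open>\<bar>D k\<bar> \<le> 2\<^sup>-\<^sup>k + 2\<^sup>k \<bar>D k\<bar>\<^sup>2\<close>, the
  subsequence converges almost everywhere. Fatou's lemma turns the pointwise limit into a limit in norm.
\<close>

lemma l2_complete:
  assumes F: "\<And>n. F n \<in> l2_space M"
    and Cauchy: "\<And>e. 0 < e \<Longrightarrow> \<exists>N. \<forall>m\<ge>N. \<forall>n\<ge>N. l2_norm M (F m - F n) < e"
  shows "\<exists>f\<in>l2_space M. (\<lambda>n. l2_norm M (F n - f)) \<longlonglongrightarrow> 0"
proof -
  have F_meas [measurable]: "F n \<in> borel_measurable M" for n
    using F by (rule l2_space_measurable)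
  obtain N where N: "\<And>k m n. m \<ge> N k \<Longrightarrow> n \<ge> N k \<Longrightarrow> l2_norm M (F m - F n) < (1/2) ^ k"
    using Cauchy[of "(1/2) ^ k" for k] by (metis zero_less_power half_gt_zero zero_less_one)
  \<comment> \<open>the summands \<open>Suc (N i)\<close> make \<open>r\<close> increasing and at least the identity, besides dominating \<open>N\<close>\<close>
  define r where "r k = (\<Sum>i\<le>k. Suc (N i))" for k
  have r_N: "N k \<le> r k" for k
    unfolding r_def using member_le_sum[of k "{..k}" "\<lambda>i. Suc (N i)"] by simp
  have r_Suc: "r k \<le> r (Suc k)" for k by (simp add: r_def)
  have r_ge: "k \<le> r k" for k
    by (induction k) (auto simp: r_def)
  define D where "D k x = F (r (Suc k)) x - F (r k) x" for k x
  have D_meas [measurable]: "D k \<in> borel_measurable M" for k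
    unfolding D_def by measurable
  have D_l2: "D k \<in> l2_space M" and D_norm: "l2_norm M (D k) < (1/2) ^ k" for k
  proof -
    have eq: "D k = F (r (Suc k)) - F (r k)" by (rule ext) (simp add: D_def)
    show "D k \<in> l2_space M" unfolding eq by (intro l2_space_diff F)
    show "l2_norm M (D k) < (1/2) ^ k"
      unfolding eq using r_N[of k] r_Suc[of k] by (intro N) auto
  qed
  have "(\<integral>\<^sup>+x. (\<Sum>k. ennreal (2 ^ k * (cmod (D k x))\<^sup>2)) \<partial>M)
      = (\<Sum>k. \<integral>\<^sup>+x. ennreal (2 ^ k * (cmod (D k x))\<^sup>2) \<partial>M)"
    by (intro nn_integral_suminf) measurable
  also have "\<dots> \<le> (\<Sum>k. ennreal ((1/2) ^ k))"
  proof (intro suminf_le summableI)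
    fix k
    have "(\<integral>\<^sup>+x. ennreal (2 ^ k * (cmod (D k x))\<^sup>2) \<partial>M) = ennreal (2 ^ k * (l2_norm M (D k))\<^sup>2)"
      using D_l2[of k] by (simp add: ennreal_mult nn_integral_cmult nn_integral_l2_norm)
    also have "\<dots> \<le> ennreal (2 ^ k * ((1/2) ^ k)\<^sup>2)"
      using D_norm[of k] l2_norm_nonneg by (intro ennreal_leI mult_left_mono power_mono) auto
    also have "2 ^ k * ((1/2) ^ k)\<^sup>2 = ((1/2) ^ k :: real)"
      by (simp add: power2_eq_square power_divide)
    finally show "(\<integral>\<^sup>+x. ennreal (2 ^ k * (cmod (D k x))\<^sup>2) \<partial>M) \<le> ennreal ((1/2) ^ k)" .
  qed
  also have "\<dots> < \<infinity>"
    by (subst suminf_ennreal2) (auto intro!: summable_geometric)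
  finally have "AE x in M. (\<Sum>k. ennreal (2 ^ k * (cmod (D k x))\<^sup>2)) \<noteq> \<infinity>"
    by (intro nn_integral_PInf_AE) auto
  then have conv: "AE x in M. (\<lambda>k. F (r k) x) \<longlonglongrightarrow> lim (\<lambda>k. F (r k) x)"
  proof eventually_elim
    case (elim x)
    have "summable (\<lambda>k. 2 ^ k * (cmod (D k x))\<^sup>2)"
      using elim summable_suminf_not_top[of "\<lambda>k. 2 ^ k * (cmod (D k x))\<^sup>2"] by simp
    then have "summable (\<lambda>k. (1/2) ^ k + 2 ^ k * (cmod (D k x))\<^sup>2)"
      by (intro summable_add[OF summable_geometric]) auto
    then have "summable (\<lambda>k. D k x)"
    proof (rule summable_comparison_test'[of _ 0])
      fix k
      \<comment> \<open>\<open>s \<le> 1 + s\<^sup>2\<close> for \<open>s = 2\<^sup>k \<bar>D k x\<bar>\<close>\<close>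
      have "0 \<le> (1 - 2 ^ k * cmod (D k x))\<^sup>2 + 2 ^ k * cmod (D k x)" by simp
      then have "2 ^ k * cmod (D k x) \<le> 1 + (2 ^ k * cmod (D k x))\<^sup>2"
        by (simp add: power2_eq_square algebra_simps)
      then have "2 ^ k * cmod (D k x) \<le> 2 ^ k * ((1/2) ^ k + 2 ^ k * (cmod (D k x))\<^sup>2)"
        by (simp add: distrib_left power_mult_distrib power_one_over power2_eq_square mult_ac)
      then show "norm (D k x) \<le> (1/2) ^ k + 2 ^ k * (cmod (D k x))\<^sup>2"
        by (rule mult_left_le_imp_le) simp
    qed
    then have "(\<lambda>n. F (r 0) x + (\<Sum>k<n. D k x)) \<longlonglongrightarrow> F (r 0) x + (\<Sum>k. D k x)"
      by (intro tendsto_intros summable_LIMSEQ)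
    moreover have "F (r 0) x + (\<Sum>k<n. D k x) = F (r n) x" for n
      by (induction n) (simp_all add: D_def algebra_simps)
    ultimately have "(\<lambda>n. F (r n) x) \<longlonglongrightarrow> F (r 0) x + (\<Sum>k. D k x)"
      by simp
    then show ?case
      using convergent_LIMSEQ_iff convergentI by blast
  qed
  define f where "f x = lim (\<lambda>k. F (r k) x)" for x
  have f_meas [measurable]: "f \<in> borel_measurable M"
    unfolding f_def by measurable
  have bound: "(\<integral>\<^sup>+x. ennreal ((cmod ((F m - f) x))\<^sup>2) \<partial>M) \<le> ennreal (e\<^sup>2)"
    if e: "0 < e" and n: "\<And>n. n \<ge> n0 \<Longrightarrow> l2_norm M (F m - F n) < e" for m n0 e
  proof -
    have "AE x in M. ennreal ((cmod ((F m - f) x))\<^sup>2) = liminf (\<lambda>k. ennreal ((cmod ((F m - F (r k)) x))\<^sup>2))"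
      using conv
    proof eventually_elim
      case (elim x)
      then have "(\<lambda>k. ennreal ((cmod ((F m - F (r k)) x))\<^sup>2)) \<longlonglongrightarrow> ennreal ((cmod ((F m - f) x))\<^sup>2)"
        unfolding f_def by (auto intro!: tendsto_intros)
      from lim_imp_Liminf[OF trivial_limit_sequentially this] show ?case by (rule sym)
    qed
    then have "(\<integral>\<^sup>+x. ennreal ((cmod ((F m - f) x))\<^sup>2) \<partial>M)
        = (\<integral>\<^sup>+x. liminf (\<lambda>k. ennreal ((cmod ((F m - F (r k)) x))\<^sup>2)) \<partial>M)"
      by (rule nn_integral_cong_AE)
    also have "\<dots> \<le> liminf (\<lambda>k. \<integral>\<^sup>+x. ennreal ((cmod ((F m - F (r k)) x))\<^sup>2) \<partial>M)"
      by (intro nn_integral_liminf) (simp add: fun_diff_def)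
    also have "\<dots> \<le> liminf (\<lambda>k::nat. ennreal (e\<^sup>2))"
    proof (rule Liminf_mono)
      show "\<forall>\<^sub>F k in sequentially. (\<integral>\<^sup>+x. ennreal ((cmod ((F m - F (r k)) x))\<^sup>2) \<partial>M) \<le> ennreal (e\<^sup>2)"
        using eventually_ge_at_top[of n0]
      proof eventually_elim
        case (elim k)
        then have "l2_norm M (F m - F (r k)) < e"
          using r_ge[of k] by (intro n) simp
        then show ?case
          using l2_norm_nonneg[of M "F m - F (r k)"]
          by (subst nn_integral_l2_norm) (auto intro!: l2_space_diff F ennreal_leI power_mono)
      qed
    qed
    also have "\<dots> = ennreal (e\<^sup>2)" by (simp add: Liminf_const)
    finally show ?thesis .
  qed
  have diff_meas: "F m - f \<in> borel_measurable M" for m by (simp add: fun_diff_def)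
  have f: "f \<in> l2_space M"
  proof -
    obtain n0 where n0: "\<And>n. n \<ge> n0 \<Longrightarrow> l2_norm M (F n0 - F n) < 1"
      using Cauchy[of 1] by auto
    then have "F n0 - f \<in> l2_space M"
      unfolding l2_space_iff
      using bound[OF zero_less_one n0] diff_meas le_less_trans ennreal_less_top by fastforce
    then have "F n0 - (F n0 - f) \<in> l2_space M"
      by (rule l2_space_diff[OF F])
    moreover have "F n0 - (F n0 - f) = f" by (simp add: fun_eq_iff)
    ultimately show ?thesis by simp
  qed
  have "(\<lambda>n. l2_norm M (F n - f)) \<longlonglongrightarrow> 0"
  proof (rule LIMSEQ_I)
    fix e :: real assume e: "0 < e"
    then obtain N where N: "\<And>m n. m \<ge> N \<Longrightarrow> n \<ge> N \<Longrightarrow> l2_norm M (F m - F n) < e / 2"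
      using Cauchy[of "e / 2"] by auto
    have "l2_norm M (F m - f) \<le> e / 2" if m: "m \<ge> N" for m
    proof (rule l2_norm_leI)
      show "(\<integral>\<^sup>+x. ennreal ((cmod ((F m - f) x))\<^sup>2) \<partial>M) \<le> ennreal ((e / 2)\<^sup>2)"
        by (rule bound[of "e / 2" N m]) (use e N[OF m] in auto)
    qed (use e l2_space_diff[OF F f] in auto)
    then have "norm (l2_norm M (F m - f) - 0) < e" if "m \<ge> N" for m
      using e that l2_norm_nonneg[of M "F m - f"] by fastforce
    then show "\<exists>N. \<forall>n\<ge>N. norm (l2_norm M (F n - f) - 0) < e" by blast
  qed
  with f show ?thesis by blast
qed

lemma l2_inner_self: "Re (l2_inner M f f) = (\<integral>x. (cmod (f x))\<^sup>2 \<partial>M)"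
  unfolding l2_inner_def complex_norm_square[symmetric] by (subst integral_complex_of_real) simp

lemma semi_hilbert_l2: "semi_hilbert (l2_space M) (\<lambda>f g. Re (l2_inner M f g))"
proof
  show "subspace (l2_space M)"
    unfolding subspace_def
    by (auto simp: l2_space_add scaleR_fun_def scaleR_conv_of_real l2_space_mult l2_space_zero zero_fun_def)
next
  fix f g assume fg: "f \<in> l2_space M" "g \<in> l2_space M"
  have "l2_inner M g f = (\<integral>x. cnj (f x * cnj (g x)) \<partial>M)"
    unfolding l2_inner_def by (simp add: mult.commute)
  also have "\<dots> = cnj (l2_inner M f g)"
    unfolding l2_inner_def by (rule Bochner_Integration.integral_cnj)
  finally have "l2_inner M g f = cnj (l2_inner M f g)" .
  then show "Re (l2_inner M f g) = Re (l2_inner M g f)" by simp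
  show "Re (l2_inner M (r *\<^sub>R f) g) = r * Re (l2_inner M f g)" for r
    unfolding l2_inner_def by simp
  fix k assume "k \<in> l2_space M"
  then show "Re (l2_inner M (f + g) k) = Re (l2_inner M f k) + Re (l2_inner M g k)"
    using fg unfolding l2_inner_def by (simp add: distrib_right integrable_l2_inner)
next
  fix f assume "f \<in> l2_space M"
  show "0 \<le> Re (l2_inner M f f)" by (simp add: l2_inner_self)
next
  fix F :: "nat \<Rightarrow> 'a \<Rightarrow> complex" assume "\<And>n. F n \<in> l2_space M"
    and "\<And>e. 0 < e \<Longrightarrow> \<exists>N. \<forall>m\<ge>N. \<forall>n\<ge>N. sqrt (Re (l2_inner M (F m - F n) (F m - F n))) < e"
  then show "\<exists>f\<in>l2_space M. (\<lambda>n. sqrt (Re (l2_inner M (F n - f) (F n - f)))) \<longlonglongrightarrow> 0"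
    using l2_complete[of F M] by (simp add: l2_inner_self l2_norm_def)
qed

interpretation L2: semi_hilbert "l2_space M" "\<lambda>f g. Re (l2_inner M f g)" for M :: "'a measure"
  by (rule semi_hilbert_l2)

lemma L2_nrm: "L2.nrm M f = l2_norm M f"
  by (simp add: L2.nrm_def l2_inner_self l2_norm_def)

lemma l2_closed_subspaceI:
  assumes S: "L2.closed_subspace M S" and J: "\<And>f. f \<in> S \<Longrightarrow> (\<lambda>x. \<i> * f x) \<in> S"
  shows "l2_closed_subspace M S"
  unfolding l2_closed_subspace_def
proof (intro conjI ballI allI impI)
  have sub: "subspace S" using S by (simp add: L2.closed_subspace_def)
  show "S \<subseteq> l2_space M" using S by (simp add: L2.closed_subspace_def)
  show "(\<lambda>x. 0) \<in> S" using subspace_0[OF sub] by (simp add: zero_fun_def)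
  show "(\<lambda>x. a * f x + b * g x) \<in> S" if fg: "f \<in> S" "g \<in> S" for f g a b
  proof -
    have mult: "(\<lambda>x. c * f x) \<in> S" if "f \<in> S" for c f
    proof -
      have "Re c *\<^sub>R f + Im c *\<^sub>R (\<lambda>x. \<i> * f x) \<in> S"
        using that J by (intro subspace_add subspace_scale sub)
      also have "Re c *\<^sub>R f + Im c *\<^sub>R (\<lambda>x. \<i> * f x) = (\<lambda>x. c * f x)"
        by (rule ext) (simp add: complex_eq_iff)
      finally show ?thesis .
    qed
    have "(\<lambda>x. a * f x) + (\<lambda>x. b * g x) \<in> S"
      by (intro subspace_add sub mult fg)
    then show ?thesis by (simp add: plus_fun_def)
  qed
  fix F f assume *: "(\<forall>n. F n \<in> S) \<and> f \<in> l2_space M \<and> (\<lambda>n. l2_norm M (\<lambda>x. F n x - f x)) \<longlonglongrightarrow> 0"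
  then have "(\<lambda>n. L2.nrm M (F n - f)) \<longlonglongrightarrow> 0"
    by (simp add: L2_nrm fun_diff_def)
  then show "f \<in> S"
    using S * unfolding L2.closed_subspace_def by blast
qed

lemma l2_closed_subspace_cong_AE:
  assumes S: "l2_closed_subspace M S" and f: "f \<in> S" and g: "g \<in> l2_space M" and eq: "AE x in M. g x = f x"
  shows "g \<in> S"
proof -
  have f': "f \<in> l2_space M" using S f by (auto simp: l2_closed_subspace_def)
  have "l2_norm M (\<lambda>x. f x - g x) = 0"
    using l2_norm_eq_0_iff[OF l2_space_diff[OF f' g]] eq by (auto simp: fun_diff_def)
  then have "(\<lambda>n. l2_norm M (\<lambda>x. f x - g x)) \<longlonglongrightarrow> 0" by simp
  moreover have "\<forall>F g. (\<forall>n. F n \<in> S) \<and> g \<in> l2_space M \<and> (\<lambda>n. l2_norm M (\<lambda>x. F n x - g x)) \<longlonglongrightarrow> 0 \<longrightarrow> g \<in> S"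
    using S unfolding l2_closed_subspace_def by blast
  ultimately show ?thesis
    using f g by (elim allE[of _ "\<lambda>n. f"] allE[of _ g]) simp
qed

section \<open>Isometries of the space of square-integrable functions\<close>

text \<open>
  Unlike the relational \<open>l2_isometry\<close>, a function on representatives that is linear without exceptional
  sets; this is the form in which the abstract theorem on isometries applies.
\<close>

definition l2_linear_isometry :: "'a measure \<Rightarrow> (('a \<Rightarrow> complex) \<Rightarrow> ('a \<Rightarrow> complex)) \<Rightarrow> bool" where
  "l2_linear_isometry M U \<longleftrightarrow>
     (\<forall>a b f g. U (\<lambda>x. a * f x + b * g x) = (\<lambda>x. a * U f x + b * U g x)) \<and>
     (\<forall>f\<in>l2_space M. U f \<in> l2_space M \<and> l2_norm M (U f) = l2_norm M f)"

lemma l2_linear_isometryD: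
  assumes "l2_linear_isometry M U"
  shows "U (\<lambda>x. a * f x + b * g x) = (\<lambda>x. a * U f x + b * U g x)"
    "f \<in> l2_space M \<Longrightarrow> U f \<in> l2_space M" "f \<in> l2_space M \<Longrightarrow> l2_norm M (U f) = l2_norm M f"
  using assms by (simp_all add: l2_linear_isometry_def)

text \<open>
  Since \<open>f\<close> is not null, complex independence of \<open>f\<close> and \<open>g\<close> says that no real \<open>a\<close>, \<open>b\<close> give
  \<open>g = a f + b J f\<close> almost everywhere; this is the form of two-dimensionality used in the real setting.
\<close>

lemma l2_linear_isometry_invariant_subspace:
  assumes U: "l2_linear_isometry M U"
    and dim: "\<exists>f\<in>l2_space M. \<exists>g\<in>l2_space M. \<forall>a b. (AE x in M. a * f x + b * g x = 0) \<longrightarrow> a = 0 \<and> b = 0"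
  obtains S where "l2_closed_subspace M S" "S \<noteq> l2_zero M" "S \<noteq> l2_space M" "\<And>f. f \<in> S \<Longrightarrow> U f \<in> S"
proof -
  note D = l2_linear_isometryD[OF U]
  obtain f g where f: "f \<in> l2_space M" and g: "g \<in> l2_space M"
    and indep: "\<And>a b. (AE x in M. a * f x + b * g x = 0) \<Longrightarrow> a = 0 \<and> b = 0"
    using dim by blast
  define J :: "('a \<Rightarrow> complex) \<Rightarrow> 'a \<Rightarrow> complex" where "J f = (\<lambda>x. \<i> * f x)" for f
  have J_l2: "J f \<in> l2_space M" if "f \<in> l2_space M" for f
    unfolding J_def using that by (rule l2_space_mult)
  obtain S where S: "L2.closed_subspace M S" "\<exists>f\<in>S. L2.nrm M f \<noteq> 0" "\<exists>f\<in>l2_space M. f \<notin> S"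
    "\<And>f. f \<in> S \<Longrightarrow> U f \<in> S" "\<And>f. f \<in> S \<Longrightarrow> J f \<in> S"
  proof (rule L2.isometry_invariant_subspace[of U M J f g])
    show "linear U"
    proof (rule linearI)
      show "U (f + g) = U f + U g" for f g
        using D(1)[of 1 f 1 g] by (simp add: plus_fun_def)
      show "U (r *\<^sub>R f) = r *\<^sub>R U f" for r f
        using D(1)[of "of_real r" f 0 f] by (simp add: scaleR_fun_def scaleR_conv_of_real)
    qed
    show "linear J"
      by (rule linearI) (auto simp: J_def fun_eq_iff algebra_simps)
    show "L2.nrm M (U k) = L2.nrm M k" if "k \<in> l2_space M" for k
      using D(3)[OF that] by (simp add: L2_nrm)
    show "L2.nrm M (J k) = L2.nrm M k" for k
      by (simp add: L2_nrm J_def l2_norm_def norm_mult)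
    show "J (J k) = - k" for k
      by (simp add: J_def fun_eq_iff)
    show "U (J k) = J (U k)" for k
      using D(1)[of \<i> k 0 k] by (simp add: J_def)
    show "L2.nrm M f \<noteq> 0"
      using indep[of 1 0] l2_norm_eq_0_iff[OF f] by (auto simp: L2_nrm)
    show "L2.nrm M (g - (a *\<^sub>R f + b *\<^sub>R J f)) \<noteq> 0" for a b
    proof
      assume 0: "L2.nrm M (g - (a *\<^sub>R f + b *\<^sub>R J f)) = 0"
      have "g - (a *\<^sub>R f + b *\<^sub>R J f) \<in> l2_space M"
        using f g J_l2[OF f] by simp
      with 0 have "AE x in M. (g - (a *\<^sub>R f + b *\<^sub>R J f)) x = 0"
        using l2_norm_eq_0_iff L2_nrm by metis
      then have "AE x in M. - Complex a b * f x + 1 * g x = 0"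
        by eventually_elim (simp add: J_def complex_eq_iff)
      from indep[OF this] show False by simp
    qed
  qed (use f g D J_l2 in auto)
  show thesis
  proof (rule that)
    show "l2_closed_subspace M S"
      using S(1,5) by (intro l2_closed_subspaceI) (auto simp: J_def)
    show "S \<noteq> l2_zero M"
      using S(2) l2_norm_eq_0_iff by (auto simp: L2_nrm l2_zero_def)
    show "S \<noteq> l2_space M" using S(3) by blast
  qed (rule S(4))
qed

lemma l2_isometry_graph:
  assumes U: "l2_linear_isometry M U"
  shows "l2_isometry M {(f, u). f \<in> l2_space M \<and> u \<in> l2_space M \<and> (AE x in M. u x = U f x)}"
    (is "l2_isometry M ?V")
  unfolding l2_isometry_def
proof (intro conjI)
  note D = l2_linear_isometryD[OF U]
  show "?V \<subseteq> l2_space M \<times> l2_space M" by auto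
  show "Domain ?V = l2_space M" using D(2) by force
  have "(\<lambda>x. a * f x + b * g x, \<lambda>x. a * u x + b * v x) \<in> ?V"
    if "(f, u) \<in> ?V" "(g, v) \<in> ?V" for f u g v a b
  proof -
    have "AE x in M. u x = U f x" "AE x in M. v x = U g x" using that by auto
    then have "AE x in M. a * u x + b * v x = a * U f x + b * U g x"
      by eventually_elim simp
    then show ?thesis using that by (simp add: l2_space_lincomb D(1))
  qed
  then show "\<forall>(f, u)\<in>?V. \<forall>(g, v)\<in>?V. \<forall>a b. (\<lambda>x. a * f x + b * g x, \<lambda>x. a * u x + b * v x) \<in> ?V"
    by blast
  have "l2_norm M u = l2_norm M f" if "(f, u) \<in> ?V" for f u
    using that l2_norm_cong_AE[of u M "U f"] D(2,3)[of f] by (simp add: l2_space_measurable)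
  then show "\<forall>(f, u)\<in>?V. l2_norm M u = l2_norm M f" by blast
qed

section \<open>Functions supported on a set\<close>

lemma l2_restrict_eq:
  "l2_restrict M A = {g \<in> l2_space M. AE x in M. x \<notin> A \<longrightarrow> g x = 0}"
proof (intro equalityI subsetI)
  fix g assume "g \<in> l2_restrict M A"
  then show "g \<in> {g \<in> l2_space M. AE x in M. x \<notin> A \<longrightarrow> g x = 0}"
    by (auto simp: l2_restrict_def elim!: eventually_mono)
next
  fix g assume g: "g \<in> {g \<in> l2_space M. AE x in M. x \<notin> A \<longrightarrow> g x = 0}"
  then have "AE x in M. g x = indicator A x * g x"
    by (auto simp: indicator_def elim!: eventually_mono)
  with g show "g \<in> l2_restrict M A" unfolding l2_restrict_def by blast
qed

text \<open>
  Off \<open>A\<close> the limit \<open>f\<close> differs from each \<open>F n\<close> by \<open>f\<close> itself, so the norm of the part of \<open>f\<close> outside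
  \<open>A\<close> is at most \<open>\<parallel>F n - f\<parallel>\<close> for every \<open>n\<close>.
\<close>

lemma l2_closed_subspace_restrict:
  assumes A [measurable]: "A \<in> sets M"
  shows "l2_closed_subspace M (l2_restrict M A)"
  unfolding l2_closed_subspace_def
proof (intro conjI ballI allI impI)
  show "l2_restrict M A \<subseteq> l2_space M" "(\<lambda>x. 0) \<in> l2_restrict M A"
    by (auto simp: l2_restrict_eq l2_space_zero)
  show "(\<lambda>x. a * f x + b * g x) \<in> l2_restrict M A"
    if "f \<in> l2_restrict M A" "g \<in> l2_restrict M A" for f g a b
    using that by (auto simp: l2_restrict_eq l2_space_lincomb elim: eventually_elim2)
  fix F f assume *: "(\<forall>n. F n \<in> l2_restrict M A) \<and> f \<in> l2_space M
    \<and> (\<lambda>n. l2_norm M (\<lambda>x. F n x - f x)) \<longlonglongrightarrow> 0"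
  then have F: "F n \<in> l2_space M" "AE x in M. x \<notin> A \<longrightarrow> F n x = 0" and f: "f \<in> l2_space M" for n
    by (auto simp: l2_restrict_eq)
  have f_meas [measurable]: "f \<in> borel_measurable M" using f by (rule l2_space_measurable)
  define k where "k x = (if x \<in> A then 0 else f x)" for x
  have k_meas [measurable]: "k \<in> borel_measurable M" unfolding k_def by measurable
  have k: "k \<in> l2_space M"
    using f unfolding l2_space_def
    by (auto intro!: Bochner_Integration.integrable_bound[of M "\<lambda>x. (cmod (f x))\<^sup>2"]) (simp add: k_def)
  have "l2_norm M k \<le> l2_norm M (\<lambda>x. F n x - f x)" for n
    unfolding l2_norm_def
  proof (intro real_sqrt_le_mono integral_mono_AE)
    show "integrable M (\<lambda>x. (cmod (k x))\<^sup>2)" using k by (simp add: l2_space_def)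
    show "integrable M (\<lambda>x. (cmod (F n x - f x))\<^sup>2)"
      using l2_space_diff[OF F(1)[of n] f] by (simp add: l2_space_def)
    show "AE x in M. (cmod (k x))\<^sup>2 \<le> (cmod (F n x - f x))\<^sup>2"
      using F(2)[of n] by eventually_elim (simp add: k_def)
  qed
  then have "l2_norm M k \<le> 0"
    using * by (intro LIMSEQ_le_const[of "\<lambda>n. l2_norm M (\<lambda>x. F n x - f x)"]) auto
  then have "l2_norm M k = 0" using l2_norm_nonneg[of M k] by linarith
  then have "AE x in M. k x = 0" using l2_norm_eq_0_iff[OF k] by simp
  then have "AE x in M. x \<notin> A \<longrightarrow> f x = 0"
    by eventually_elim (auto simp: k_def split: if_splits)
  with f show "f \<in> l2_restrict M A" by (simp add: l2_restrict_eq)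
qed

text \<open>
  The square root of a strictly positive integrable function, cut off outside \<open>A\<close>. Sigma-finiteness
  provides that function even when no indicator function of \<open>A\<close> is square-integrable.
\<close>

lemma (in sigma_finite_measure) exists_l2_supported_on:
  assumes A [measurable]: "A \<in> sets M" and pos: "\<not> (AE x in M. x \<notin> A)"
  obtains f where "f \<in> l2_space M" "\<And>x. x \<notin> A \<Longrightarrow> f x = 0" "\<not> (AE x in M. f x = 0)"
proof -
  obtain \<rho> :: "'a \<Rightarrow> ennreal" where \<rho> [measurable]: "\<rho> \<in> borel_measurable M"
    and fin: "integral\<^sup>N M \<rho> \<noteq> \<infinity>" and \<rho>_pos: "\<And>x. x \<in> space M \<Longrightarrow> 0 < \<rho> x \<and> \<rho> x < \<infinity>"
    using Ex_finite_integrable_function by blast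
  define f where "f x = (if x \<in> A then complex_of_real (sqrt (enn2real (\<rho> x))) else 0)" for x
  have [measurable]: "f \<in> borel_measurable M" unfolding f_def by measurable
  have "(\<integral>\<^sup>+x. ennreal ((cmod (f x))\<^sup>2) \<partial>M) \<le> integral\<^sup>N M \<rho>"
    using \<rho>_pos by (intro nn_integral_mono) (auto simp: f_def)
  then have "f \<in> l2_space M"
    using fin by (auto simp: l2_space_iff less_top[symmetric] top_unique)
  moreover have "\<not> (AE x in M. f x = 0)"
  proof
    assume "AE x in M. f x = 0"
    then have "AE x in M. x \<notin> A"
      using AE_space
    proof eventually_elim
      case (elim x)
      then show ?case using \<rho>_pos[of x] by (auto simp: f_def enn2real_eq_0_iff split: if_splits)
    qed
    with pos show False by simp
  qed
  ultimately show thesis using that[of f] by (simp add: f_def)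
qed

text \<open>
  With \<open>c\<close> the essential supremum, \<open>h \<le> c\<close> almost everywhere but not \<open>h = c\<close>. The set \<open>{h < c}\<close> is the union
  of the sets \<open>{h \<le> q}\<close> over the countably many rationals \<open>q < c\<close>, so one of these is not null, while
  \<open>{h > q}\<close> is not null by the choice of \<open>c\<close>.
\<close>

lemma nonconstant_level:
  fixes h :: "'a \<Rightarrow> ennreal"
  assumes h [measurable]: "h \<in> borel_measurable M" and nonconst: "\<And>c. \<not> (AE x in M. h x = c)"
  obtains t :: real where "0 \<le> t" "\<not> (AE x in M. h x \<le> ennreal t)" "\<not> (AE x in M. ennreal t < h x)"
proof -
  define c where "c = esssup M h"
  have upper: "AE x in M. h x \<le> c" unfolding c_def by (rule esssup_AE)
  have "\<exists>q::rat. ennreal (real_of_rat q) < c \<and> \<not> (AE x in M. ennreal (real_of_rat q) < h x)"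
  proof (rule ccontr)
    assume "\<not> ?thesis"
    then have "AE x in M. ennreal (real_of_rat q) < c \<longrightarrow> ennreal (real_of_rat q) < h x" for q
      by (cases "ennreal (real_of_rat q) < c") auto
    then have "AE x in M. \<forall>q. ennreal (real_of_rat q) < c \<longrightarrow> ennreal (real_of_rat q) < h x"
      by (subst AE_all_countable) blast
    with upper have "AE x in M. h x = c"
    proof eventually_elim
      case (elim x)
      show ?case
      proof (rule ccontr)
        assume "h x \<noteq> c"
        then have "h x < c" using elim by simp
        from ennreal_rat_dense[OF this] show False using elim by force
      qed
    qed
    with nonconst show False by blast
  qed
  then obtain q :: rat where q: "ennreal (real_of_rat q) < c" "\<not> (AE x in M. ennreal (real_of_rat q) < h x)"
    by blast
  \<comment> \<open>a negative rational becomes \<open>0\<close> as an extended nonnegative real, so the level does not change\<close>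
  define t where "t = max 0 (real_of_rat q)"
  have t: "ennreal t = ennreal (real_of_rat q)" by (simp add: t_def max_def ennreal_neg)
  have "\<not> (AE x in M. h x \<le> ennreal t)"
    using esssup_I[OF h, of "ennreal t"] q(1) unfolding t c_def by auto
  then show thesis using that[of t] q(2) unfolding t by (simp add: t_def)
qed

section \<open>Weighted composition operators\<close>

locale weighted_composition = sigma_finite_measure M for M :: "'a measure" +
  fixes \<phi> :: "'a \<Rightarrow> 'a" and w :: "'a \<Rightarrow> complex"
  assumes \<phi>_measurable [measurable]: "\<phi> \<in> measurable M M"
    and w_measurable [measurable]: "w \<in> borel_measurable M"
    and push_forward_ac: "absolutely_continuous M (distr (weighted_measure M w) M \<phi>)"
begin

abbreviation h :: "'a \<Rightarrow> ennreal" where "h \<equiv> wco_h M \<phi> w"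

lemma h_measurable [measurable]: "h \<in> borel_measurable M"
  unfolding wco_h_def by simp

lemma sets_weighted_measure [measurable_cong]: "sets (weighted_measure M w) = sets M"
  by (simp add: weighted_measure_def)

lemma density_h: "density M h = distr (weighted_measure M w) M \<phi>"
  unfolding wco_h_def by (rule density_RN_deriv[OF push_forward_ac]) simp

lemma nn_integral_wco:
  assumes f [measurable]: "f \<in> borel_measurable M"
  shows "(\<integral>\<^sup>+x. ennreal ((cmod (w x * f (\<phi> x)))\<^sup>2) \<partial>M) = (\<integral>\<^sup>+x. h x * ennreal ((cmod (f x))\<^sup>2) \<partial>M)"
proof -
  have "(\<integral>\<^sup>+x. h x * ennreal ((cmod (f x))\<^sup>2) \<partial>M) = (\<integral>\<^sup>+x. ennreal ((cmod (f x))\<^sup>2) \<partial>density M h)"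
    by (subst nn_integral_density) auto
  also have "\<dots> = (\<integral>\<^sup>+x. ennreal ((cmod (f (\<phi> x)))\<^sup>2) \<partial>weighted_measure M w)"
    unfolding density_h by (subst nn_integral_distr) auto
  also have "\<dots> = (\<integral>\<^sup>+x. ennreal ((cmod (w x * f (\<phi> x)))\<^sup>2) \<partial>M)"
    unfolding weighted_measure_def
    by (subst nn_integral_density) (auto simp: norm_mult power_mult_distrib ennreal_mult)
  finally show ?thesis by simp
qed

lemma AE_weighted_measure: "(AE x in weighted_measure M w. P x) \<longleftrightarrow> (AE x in M. w x \<noteq> 0 \<longrightarrow> P x)"
  unfolding weighted_measure_def by (subst AE_density) auto

text \<open>
  Almost everywhere statements pull back along \<open>\<phi>\<close> because the push-forward of the weighted measure does
  not charge null sets; where \<open>w\<close> vanishes the weighted measure does not see the point.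
\<close>

lemma AE_comp:
  assumes "AE x in M. P x"
  shows "AE x in M. w x \<noteq> 0 \<longrightarrow> P (\<phi> x)"
proof -
  have "AE x in distr (weighted_measure M w) M \<phi>. P x"
    by (rule absolutely_continuous_AE[OF _ push_forward_ac assms]) simp
  then have "AE x in weighted_measure M w. P (\<phi> x)"
    by (rule AE_distrD[rotated]) measurable
  then show ?thesis by (simp add: AE_weighted_measure)
qed

text \<open>
  At a point where \<open>w \<noteq> 0\<close> and \<open>h \<le> t\<close>, the image under \<open>\<phi>\<close> still satisfies \<open>h \<le> t\<close>, so \<open>f\<close> vanishes there.
\<close>

lemma level_set_invariant:
  assumes mono: "AE x in weighted_measure M w. h (\<phi> x) \<le> h x"
  shows "l2_invariant (wco M \<phi> w) (l2_restrict M {x \<in> space M. t < h x})"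
  unfolding l2_invariant_def
proof safe
  fix f u assume fu: "(f, u) \<in> wco M \<phi> w" and f: "f \<in> l2_restrict M {x \<in> space M. t < h x}"
  have "AE x in M. x \<notin> {x \<in> space M. t < h x} \<longrightarrow> f x = 0"
    using f by (simp add: l2_restrict_eq)
  note f_comp = AE_comp[OF this]
  have "AE x in M. u x = w x * f (\<phi> x)" using fu by (simp add: wco_def)
  from this f_comp mono[unfolded AE_weighted_measure] AE_space
  have "AE x in M. x \<notin> {x \<in> space M. t < h x} \<longrightarrow> u x = 0"
  proof eventually_elim
    case (elim x)
    then show ?case by (cases "w x = 0") (auto dest: less_le_trans)
  qed
  then show "u \<in> l2_restrict M {x \<in> space M. t < h x}"
    using fu by (simp add: l2_restrict_eq wco_def)
qed

text \<open>
  Where \<open>h\<close> is infinite, finiteness of \<open>\<integral>h \<bar>g\<bar>\<^sup>2\<close> forces \<open>g\<close> to vanish. If that were almost everywhere,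
  the domain would contain null functions only and could not be dense in a nonzero space.
\<close>

lemma h_not_infinite:
  assumes dense: "l2_densely_defined M (wco M \<phi> w)"
    and f: "f \<in> l2_space M" "\<not> (AE x in M. f x = 0)"
  shows "\<not> (AE x in M. h x = \<infinity>)"
proof
  assume inf: "AE x in M. h x = \<infinity>"
  have null: "AE x in M. g x = 0" if "g \<in> Domain (wco M \<phi> w)" for g
  proof -
    have g: "g \<in> l2_space M" "(\<lambda>x. w x * g (\<phi> x)) \<in> l2_space M"
      using that Domain_wco[OF \<phi>_measurable w_measurable] by auto
    then have [measurable]: "g \<in> borel_measurable M" by (simp add: l2_space_def)
    have "(\<integral>\<^sup>+x. h x * ennreal ((cmod (g x))\<^sup>2) \<partial>M) \<noteq> \<infinity>"
      using g(2) nn_integral_wco[of g] by (simp add: l2_space_iff)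
    then have "AE x in M. h x * ennreal ((cmod (g x))\<^sup>2) \<noteq> \<infinity>"
      by (intro nn_integral_PInf_AE) auto
    with inf show ?thesis
      by eventually_elim (auto simp: ennreal_top_mult split: if_splits)
  qed
  have "l2_norm M f < e" if e: "0 < e" for e
  proof -
    obtain g where g: "g \<in> Domain (wco M \<phi> w)" "l2_norm M (\<lambda>x. f x - g x) < e"
      using dense f(1) e unfolding l2_densely_defined_def by blast
    then have g': "g \<in> borel_measurable M" by (auto simp: wco_def l2_space_def)
    have "AE x in M. f x - g x = f x" using null[OF g(1)] by eventually_elim simp
    then have "l2_norm M (\<lambda>x. f x - g x) = l2_norm M f"
      using f(1) g' by (intro l2_norm_cong_AE) (auto simp: l2_space_def)
    with g show ?thesis by simp
  qed
  then have "l2_norm M f = 0"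
    using l2_norm_nonneg[of M f] by (metis less_irrefl order_le_less)
  with f show False using l2_norm_eq_0_iff by blast
qed

text \<open>
  For \<open>c > 0\<close> the operator divided by \<open>sqrt c\<close> is isometric. For \<open>c = 0\<close> the operator vanishes and is \<open>0\<close> times
  the identity.
\<close>

lemma constant_h_multiple_of_isometry:
  assumes const: "AE x in M. h x = ennreal c" and c: "0 \<le> c"
  obtains U k where "l2_linear_isometry M U"
    "\<And>f. f \<in> l2_space M \<Longrightarrow> AE x in M. w x * f (\<phi> x) = k * U f x"
proof -
  have nn: "(\<integral>\<^sup>+x. ennreal ((cmod (w x * f (\<phi> x)))\<^sup>2) \<partial>M) = ennreal (c * (l2_norm M f)\<^sup>2)"
    if f: "f \<in> l2_space M" for f
  proof -
    have [measurable]: "f \<in> borel_measurable M" using f by (rule l2_space_measurable)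
    have "(\<integral>\<^sup>+x. h x * ennreal ((cmod (f x))\<^sup>2) \<partial>M) = (\<integral>\<^sup>+x. ennreal c * ennreal ((cmod (f x))\<^sup>2) \<partial>M)"
      by (intro nn_integral_cong_AE) (use const in \<open>auto elim: eventually_mono\<close>)
    then show ?thesis
      using f c by (simp add: nn_integral_wco nn_integral_cmult nn_integral_l2_norm ennreal_mult)
  qed
  have wf: "(\<lambda>x. w x * f (\<phi> x)) \<in> l2_space M" if f: "f \<in> l2_space M" for f
  proof -
    have [measurable]: "f \<in> borel_measurable M" using f by (rule l2_space_measurable)
    show ?thesis using nn[OF f] by (simp add: l2_space_iff)
  qed
  have norm: "(l2_norm M (\<lambda>x. w x * f (\<phi> x)))\<^sup>2 = c * (l2_norm M f)\<^sup>2" if f: "f \<in> l2_space M" for f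
    using nn_integral_l2_norm[OF wf[OF f]] nn[OF f] c by simp
  show thesis
  proof (cases "c = 0")
    case True
    show thesis
    proof (rule that[of "\<lambda>f. f" 0])
      show "l2_linear_isometry M (\<lambda>f. f)" by (simp add: l2_linear_isometry_def)
      show "AE x in M. w x * f (\<phi> x) = 0 * f x" if f: "f \<in> l2_space M" for f
        using norm[OF f] True l2_norm_eq_0_iff[OF wf[OF f]] by simp
    qed
  next
    case False
    define k where "k = sqrt c"
    have k: "0 < k" "k\<^sup>2 = c" using c False by (auto simp: k_def)
    define U :: "('a \<Rightarrow> complex) \<Rightarrow> 'a \<Rightarrow> complex" where
      "U f = (\<lambda>x. complex_of_real (1 / k) * (w x * f (\<phi> x)))" for f
    show thesis
    proof (rule that[of U "complex_of_real k"])
      have "l2_norm M (U f) = l2_norm M f" if f: "f \<in> l2_space M" for f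
      proof (rule power2_eq_imp_eq)
        have "(l2_norm M (U f))\<^sup>2 = (1 / k)\<^sup>2 * (l2_norm M (\<lambda>x. w x * f (\<phi> x)))\<^sup>2"
          by (simp add: l2_norm_square U_def norm_mult norm_divide power_mult_distrib power_divide)
        then show "(l2_norm M (U f))\<^sup>2 = (l2_norm M f)\<^sup>2"
          using k norm[OF f] False by (simp add: power_divide)
      qed (auto intro: l2_norm_nonneg)
      moreover have "U f \<in> l2_space M" if "f \<in> l2_space M" for f
        unfolding U_def by (rule l2_space_mult[OF wf[OF that]])
      moreover have "U (\<lambda>x. a * f x + b * g x) = (\<lambda>x. a * U f x + b * U g x)" for a b f g
        by (simp add: U_def fun_eq_iff algebra_simps)
      ultimately show "l2_linear_isometry M U" by (simp add: l2_linear_isometry_def)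
      show "AE x in M. w x * f (\<phi> x) = complex_of_real k * U f x" for f
        using k(1) by (simp add: U_def)
    qed
  qed
qed

lemma wco_eq_scaled_isometry:
  assumes U: "l2_linear_isometry M U"
    and eq: "\<And>f. f \<in> l2_space M \<Longrightarrow> AE x in M. w x * f (\<phi> x) = k * U f x"
  shows "wco M \<phi> w = l2_scale M k {(f, u). f \<in> l2_space M \<and> u \<in> l2_space M \<and> (AE x in M. u x = U f x)}"
proof -
  have "(f, u) \<in> wco M \<phi> w \<longleftrightarrow>
    (f, u) \<in> l2_scale M k {(f, u). f \<in> l2_space M \<and> u \<in> l2_space M \<and> (AE x in M. u x = U f x)}" for f u
  proof
    assume "(f, u) \<in> wco M \<phi> w"
    then have f: "f \<in> l2_space M" and u: "u \<in> l2_space M" "AE x in M. u x = w x * f (\<phi> x)"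
      by (auto simp: wco_def)
    from u(2) eq[OF f] have "AE x in M. u x = k * U f x" by eventually_elim simp
    then show "(f, u) \<in> l2_scale M k {(f, u). f \<in> l2_space M \<and> u \<in> l2_space M \<and> (AE x in M. u x = U f x)}"
      using f u(1) l2_linear_isometryD(2)[OF U f] by (auto simp: l2_scale_def intro!: exI[of _ "U f"])
  next
    assume "(f, u) \<in> l2_scale M k {(f, u). f \<in> l2_space M \<and> u \<in> l2_space M \<and> (AE x in M. u x = U f x)}"
    then obtain v where f: "f \<in> l2_space M" and u: "u \<in> l2_space M"
      and v: "AE x in M. v x = U f x" "AE x in M. u x = k * v x"
      by (auto simp: l2_scale_def)
    from v eq[OF f] have "AE x in M. u x = w x * f (\<phi> x)" by eventually_elim simp
    with f u show "(f, u) \<in> wco M \<phi> w" by (simp add: wco_def)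
  qed
  then show ?thesis by auto
qed

end

theorem theorem27:
  fixes \<mu> :: "'a measure" and \<phi> :: "'a \<Rightarrow> 'a" and w :: "'a \<Rightarrow> complex"
  assumes "sigma_finite_measure \<mu>"
    and "\<phi> \<in> measurable \<mu> \<mu>"
    and "w \<in> borel_measurable \<mu>"
    and "absolutely_continuous \<mu> (distr (weighted_measure \<mu> w) \<mu> \<phi>)"
    and dim_ge_2: "\<exists>f\<in>l2_space \<mu>. \<exists>g\<in>l2_space \<mu>. \<forall>a b. (AE x in \<mu>. a * f x + b * g x = 0) \<longrightarrow> a = 0 \<and> b = 0"
    and "l2_densely_defined \<mu> (wco \<mu> \<phi> w)"
    and "AE x in weighted_measure \<mu> w. wco_E \<mu> \<phi> w (wco_h \<mu> \<phi> w) x = wco_h \<mu> \<phi> w x"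
    and "AE x in weighted_measure \<mu> w. wco_h \<mu> \<phi> w (\<phi> x) \<le> wco_h \<mu> \<phi> w x"
  shows "\<exists>S. l2_closed_subspace \<mu> S \<and> S \<noteq> l2_zero \<mu> \<and> S \<noteq> l2_space \<mu> \<and>
           l2_invariant (wco \<mu> \<phi> w) S \<and>
           (l2_kernel \<mu> (wco \<mu> \<phi> w) = l2_zero \<mu> \<and>
            l2_kernel \<mu> (l2_adjoint \<mu> (wco \<mu> \<phi> w)) = l2_zero \<mu> \<and>
            \<not> (\<exists>c V. l2_isometry \<mu> V \<and> wco \<mu> \<phi> w = l2_scale \<mu> c V) \<longrightarrow>
            (\<exists>t\<^sub>0::real. S = l2_restrict \<mu> {x \<in> space \<mu>. ereal t\<^sub>0 < enn2ereal (wco_h \<mu> \<phi> w x)}))"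
proof -
  interpret weighted_composition \<mu> \<phi> w
    using assms by (intro weighted_composition.intro weighted_composition_axioms.intro)
  show ?thesis
  proof (cases "\<exists>c. AE x in \<mu>. h x = c")
    case False
    then obtain t where t: "0 \<le> t" and above: "\<not> (AE x in \<mu>. h x \<le> ennreal t)"
      and below: "\<not> (AE x in \<mu>. ennreal t < h x)"
      using nonconstant_level[OF h_measurable] by blast
    define A where "A = {x \<in> space \<mu>. ennreal t < h x}"
    have A [measurable]: "A \<in> sets \<mu>" unfolding A_def by measurable
    have "\<not> (AE x in \<mu>. x \<notin> A)"
      using above AE_space by (auto simp: A_def not_less elim!: eventually_rev_mp)
    then obtain f where f: "f \<in> l2_space \<mu>" "\<And>x. x \<notin> A \<Longrightarrow> f x = 0" "\<not> (AE x in \<mu>. f x = 0)"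
      using exists_l2_supported_on[OF A] by blast
    have "\<not> (AE x in \<mu>. x \<notin> space \<mu> - A)"
      using below AE_space by (auto simp: A_def elim!: eventually_rev_mp)
    then obtain g where g: "g \<in> l2_space \<mu>" "\<And>x. x \<notin> space \<mu> - A \<Longrightarrow> g x = 0" "\<not> (AE x in \<mu>. g x = 0)"
      using exists_l2_supported_on[of "space \<mu> - A"] A by blast
    have "f \<in> l2_restrict \<mu> A" using f by (simp add: l2_restrict_eq)
    then have "l2_restrict \<mu> A \<noteq> l2_zero \<mu>" using f(3) by (auto simp: l2_zero_def)
    moreover have "g \<notin> l2_restrict \<mu> A"
    proof
      assume "g \<in> l2_restrict \<mu> A"
      then have "AE x in \<mu>. x \<notin> A \<longrightarrow> g x = 0" by (simp add: l2_restrict_eq)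
      then have "AE x in \<mu>. g x = 0" by eventually_elim (use g(2) in auto)
      with g(3) show False by simp
    qed
    moreover have "l2_invariant (wco \<mu> \<phi> w) (l2_restrict \<mu> A)"
      unfolding A_def using assms(8) by (rule level_set_invariant)
    moreover have "A = {x \<in> space \<mu>. ereal t < enn2ereal (h x)}"
      using t by (simp add: A_def less_ennreal.rep_eq)
    ultimately show ?thesis
      using l2_closed_subspace_restrict[OF A] g(1) by blast
  next
    case True
    then obtain d where d: "AE x in \<mu>. h x = d" by blast
    obtain f g where f: "f \<in> l2_space \<mu>"
      and indep: "\<And>a b. (AE x in \<mu>. a * f x + b * g x = 0) \<Longrightarrow> a = 0 \<and> b = 0"
      using dim_ge_2 by blast
    have "\<not> (AE x in \<mu>. f x = 0)" using indep[of 1 0] by auto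
    then have "d \<noteq> \<infinity>" using h_not_infinite[OF assms(6) f] d by auto
    then obtain c where c: "0 \<le> c" "d = ennreal c" by (cases d) auto
    obtain U k where U: "l2_linear_isometry \<mu> U"
      and eq: "\<And>f. f \<in> l2_space \<mu> \<Longrightarrow> AE x in \<mu>. w x * f (\<phi> x) = k * U f x"
      using constant_h_multiple_of_isometry[OF d[unfolded c(2)] c(1)] by blast
    obtain S where S: "l2_closed_subspace \<mu> S" "S \<noteq> l2_zero \<mu>" "S \<noteq> l2_space \<mu>" "\<And>f. f \<in> S \<Longrightarrow> U f \<in> S"
      using l2_linear_isometry_invariant_subspace[OF U dim_ge_2] by blast
    have "l2_invariant (wco \<mu> \<phi> w) S"
      unfolding l2_invariant_def
    proof safe
      fix f u assume "(f, u) \<in> wco \<mu> \<phi> w" and fS: "f \<in> S"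
      then have u: "u \<in> l2_space \<mu>" "AE x in \<mu>. u x = w x * f (\<phi> x)" and f: "f \<in> l2_space \<mu>"
        by (auto simp: wco_def)
      \<comment> \<open>the second summand only serves to match the closure of \<open>S\<close> under linear combinations\<close>
      have "(\<lambda>x. k * U f x + 0 * U f x) \<in> S"
        using S(1) S(4)[OF fS] unfolding l2_closed_subspace_def by blast
      then have kU: "(\<lambda>x. k * U f x) \<in> S" by simp
      from u(2) eq[OF f] have "AE x in \<mu>. u x = k * U f x" by eventually_elim simp
      then show "u \<in> S" by (rule l2_closed_subspace_cong_AE[OF S(1) kU u(1)])
    qed
    moreover have "\<exists>c V. l2_isometry \<mu> V \<and> wco \<mu> \<phi> w = l2_scale \<mu> c V"
      using l2_isometry_graph[OF U] wco_eq_scaled_isometry[OF U eq] by blast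
    ultimately show ?thesis using S(1-3) by blast
  qed
qed

end
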